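(* Let $(\delta^*,\omega^* )\in\Omega$ be an equilibrium point (EP) of the multi-microgrid system $$\dot\delta_i=\omega_i,\qquad m_i\dot\omega_i+d_i\omega_i=P_{s_i}-P_{e_i}(\delta),\qquad i\in\mathcal N=\{1,\dots,n\},$$ and let $J$ be the Jacobian of the vector field at this EP. Suppose $m_i>0$ and $d_i>0$ for all $i\in\mathcal N$, and that the linking grid $\mathcal G$ is connected. If $$\sum_{k=1,\,k\ne i}^nV_iV_kY_{ik}\le\frac{d_i^2}{2m_i}\qquad\forall i\in\mathcal N,$$ then the nonzero eigenvalues of $J$ are located in the open left half plane and the EP is locally asymptotically stable.
   Context: Network. $\mathcal G=(\mathcal N,\mathcal E)$ is an undirected graph with $\mathcal N=\{1,\dots,n\}$ (nodes are microgrids). Distinct nodes $i,k$ are joined by a line of admittance $y_{ik}=y_{ki}=g_{ik}+\mathrm j b_{ik}$ with $g_{ik}\ge 0$, $b_{ik}\le 0$ ($y_{ik}=0$ if there is no line); $y_{ii}$ is the admittance-to-ground at node $i$. The symmetric admittance matrix has diagonal entries $Y_{ii}\measuredangle\theta_{ii}=\sum_{k=1}^n y_{ik}$ and off-diagonal entries $Y_{ik}\measuredangle\theta_{ik}=-y_{ik}$, where $Y_{ik}\ge 0$ is the modulus and $\theta_{ik}$ the argument. $\mathcal G$ is connected if any two distinct nodes are joined by a path of lines with nonzero admittance. $\mathcal A$ is the set of ordered pairs $(i,k)$, $i\ne k$, with $y_{ik}\neq 0$. Dynamics. $V_i>0$ are constant voltage magnitudes, $P_{s_i}\in\mathbb R$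 are constant setpoints, $m_i$ is the inertia and $d_i$ the damping of node $i$, and $$P_{e_i}(\delta)=\sum_{k=1}^n V_iV_kY_{ik}\cos(\theta_{ik}-\delta_i+\delta_k).$$ An EP is a point $(\delta^*,\omega^* )\in\mathbb R^{2n}$ with $\omega^*=0$ and $P_{e_i}(\delta^* )=P_{s_i}$ for all $i$. Moreover $$\Omega=\{(\delta,\omega)\in\mathbb R^{2n}:\ 0<\theta_{ik}-\delta_i+\delta_k<\pi\ \ \forall (i,k)\in\mathcal A,\ \omega=0\}.$$ Jacobian. With $M=\mathrm{diag}(m_1,\dots,m_n)$, $D=\mathrm{diag}(d_1,\dots,d_n)$ and $L$ the Jacobian matrix of $P_e=(P_{e_1},\dots,P_{e_n})$ at $\delta^*$, i.e. $L_{ii}=\sum_{k\ne i}V_iV_kY_{ik}\sin(\theta_{ik}-\delta^*_i+\delta^*_k)$ and $L_{ik}=-V_iV_kY_{ik}\sin(\theta_{ik}-\delta^*_i+\delta^*_k)$ for $i\ne k$, $$J=\begin{bmatrix}0&I\\-M^{-1}L&-M^{-1}D\end{bmatrix}\in\mathbb R^{2n\times 2n}.$$ Stability convention. Since $P_e(\delta+\alpha\mathbf 1)=P_e(\delta)$ for all $\alpha\in\mathbb R$ ($\mathbf 1$ the all-ones vector), EPs come in families $\{(\delta^*+\alpha\mathbf 1,0):\alpha\in\mathbb R\}$. Local asymptotic stability of an EP is understood after choosing a reference bus and referring all other angles to it (equivalently, for the induced system on $(\mathbb R^n/\mathbb R\mathbf 1)\times\mathbb R^n$), so that each such family becomes a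 single EP. *)

theory Defs
  imports "HOL-Analysis.Analysis"
begin

section \<open>Network\<close>

text \<open>
  Off the diagonal, \<open>y $ i $ k\<close> is the admittance of the line joining \<open>i\<close> and \<open>k\<close> (zero if there is
  none); \<open>y $ i $ i\<close> is the admittance-to-ground at node \<open>i\<close>, which is why the whole row is summed
  on the diagonal below.
\<close>

definition admittance_matrix :: "complex^'n^'n \<Rightarrow> complex^'n^'n" where
  "admittance_matrix y = (\<chi> i k. if i = k then (\<Sum>l\<in>UNIV. y $ i $ l) else - y $ i $ k)"

definition Ymod :: "complex^'n^'n \<Rightarrow> 'n \<Rightarrow> 'n \<Rightarrow> real" where
  "Ymod y i k = cmod (admittance_matrix y $ i $ k)"

text \<open>
  The principal argument in \<open>(-\<pi>, \<pi>]\<close>. A line has conductance \<open>\<ge> 0\<close> and susceptance \<open>\<le> 0\<close>, so for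
  \<open>(i, k) \<in> lines y\<close> the angle lies in \<open>[\<pi>/2, \<pi>]\<close>.
\<close>

definition Yarg :: "complex^'n^'n \<Rightarrow> 'n \<Rightarrow> 'n \<Rightarrow> real" where
  "Yarg y i k = Arg (admittance_matrix y $ i $ k)"

definition lines :: "complex^'n^'n \<Rightarrow> ('n \<times> 'n) set" where
  "lines y = {(i, k). i \<noteq> k \<and> y $ i $ k \<noteq> 0}"

definition grid_connected :: "complex^'n^'n \<Rightarrow> bool" where
  "grid_connected y \<longleftrightarrow> (\<forall>i k. i \<noteq> k \<longrightarrow> (i, k) \<in> (lines y)\<^sup>+)"


section \<open>Dynamics\<close>

text \<open>
  A state \<open>(\<delta>, \<omega>)\<close> of the system is a vector over the index type \<open>'n + 'n\<close>: the components
  \<open>Inl i\<close> are the angles and the components \<open>Inr i\<close> the frequencies.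
\<close>

definition angles :: "real^('n + 'n) \<Rightarrow> real^'n" where
  "angles x = (\<chi> i. x $ Inl i)"

definition freqs :: "real^('n + 'n) \<Rightarrow> real^'n" where
  "freqs x = (\<chi> i. x $ Inr i)"

definition state :: "real^'n \<Rightarrow> real^'n \<Rightarrow> real^('n + 'n)" where
  "state \<delta> \<omega> = (\<chi> s. case s of Inl i \<Rightarrow> \<delta> $ i | Inr i \<Rightarrow> \<omega> $ i)"

definition Pe :: "complex^'n^'n \<Rightarrow> real^'n \<Rightarrow> real^'n \<Rightarrow> real^'n" where
  "Pe y V \<delta> = (\<chi> i. \<Sum>k\<in>UNIV. V $ i * V $ k * Ymod y i k * cos (Yarg y i k - \<delta> $ i + \<delta> $ k))"

definition microgrid_field ::
  "complex^'n^'n \<Rightarrow> real^'n \<Rightarrow> real^'n \<Rightarrow> real^'n \<Rightarrow> real^'n \<Rightarrow> real^('n + 'n) \<Rightarrow> real^('n + 'n)"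
  where
  "microgrid_field y V Ps m d x =
     state (freqs x) (\<chi> i. (Ps $ i - Pe y V (angles x) $ i - d $ i * freqs x $ i) / m $ i)"

definition equilibrium_point ::
  "complex^'n^'n \<Rightarrow> real^'n \<Rightarrow> real^'n \<Rightarrow> real^('n + 'n) \<Rightarrow> bool" where
  "equilibrium_point y V Ps x \<longleftrightarrow> freqs x = 0 \<and> (\<forall>i. Pe y V (angles x) $ i = Ps $ i)"

definition Omega :: "complex^'n^'n \<Rightarrow> (real^('n + 'n)) set" where
  "Omega y = {x. (\<forall>(i, k)\<in>lines y. 0 < Yarg y i k - angles x $ i + angles x $ k \<and>
                                   Yarg y i k - angles x $ i + angles x $ k < pi) \<and>
                 freqs x = 0}"


section \<open>Eigenvalues and asymptotic stability\<close>

definition complex_eigenvalue :: "real^'a^'a \<Rightarrow> complex \<Rightarrow> bool" where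
  "complex_eigenvalue A \<mu> \<longleftrightarrow> (\<exists>v::complex^'a. v \<noteq> 0 \<and> map_matrix of_real A *v v = \<mu> *s v)"

definition solves_ode_in ::
  "'a::real_normed_vector set \<Rightarrow> ('a \<Rightarrow> 'a) \<Rightarrow> (real \<Rightarrow> 'a) \<Rightarrow> bool" where
  "solves_ode_in X f x \<longleftrightarrow>
     (\<forall>t\<ge>0. x t \<in> X \<and> (x has_vector_derivative f (x t)) (at t within {0..}))"

text \<open>
  Local asymptotic stability of the equilibrium \<open>p\<close> of \<open>x' = f x\<close> on the state space \<open>X\<close>.
  Solutions starting near \<open>p\<close> are required to exist for all forward time, so that the conditions
  on trajectories are never vacuous.
\<close>

definition locally_asymptotically_stable ::
  "'a::real_normed_vector set \<Rightarrow> ('a \<Rightarrow> 'a) \<Rightarrow> 'a \<Rightarrow> bool" where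
  "locally_asymptotically_stable X f p \<longleftrightarrow>
     p \<in> X \<and> f p = 0 \<and>
     (\<exists>\<rho>>0. \<forall>x0\<in>X. dist x0 p < \<rho> \<longrightarrow> (\<exists>x. solves_ode_in X f x \<and> x 0 = x0)) \<and>
     (\<forall>\<epsilon>>0. \<exists>\<rho>>0. \<forall>x. solves_ode_in X f x \<and> dist (x 0) p < \<rho> \<longrightarrow>
        (\<forall>t\<ge>0. dist (x t) p < \<epsilon>)) \<and>
     (\<exists>\<rho>>0. \<forall>x. solves_ode_in X f x \<and> dist (x 0) p < \<rho> \<longrightarrow> (x \<longlongrightarrow> p) at_top)"


section \<open>Referring the angles to a reference bus\<close>

definition refer_to :: "'n::finite \<Rightarrow> real^('n + 'n) \<Rightarrow> real^('n + 'n)" where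
  "refer_to r x = state (\<chi> i. angles x $ i - angles x $ r) (freqs x)"

definition referred_states :: "'n::finite \<Rightarrow> (real^('n + 'n)) set" where
  "referred_states r = {x. angles x $ r = 0}"

text \<open>
  Since \<open>refer_to r\<close> is linear and the field only depends on the referred state (see below), the
  referred state of any trajectory of the system moves along the composed field.
\<close>

definition referred_field ::
  "complex^'n^'n \<Rightarrow> real^'n \<Rightarrow> real^'n \<Rightarrow> real^'n \<Rightarrow> real^'n \<Rightarrow> 'n::finite \<Rightarrow> real^('n + 'n) \<Rightarrow> real^('n + 'n)"
  where
  "referred_field y V Ps m d r x = refer_to r (microgrid_field y V Ps m d x)"

lemma microgrid_field_refer_to:
  "microgrid_field y V Ps m d (refer_to r x) = microgrid_field y V Ps m d x"
  by (simp add: microgrid_field_def refer_to_def state_def angles_def freqs_def Pe_def algebra_simps)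

lemma referred_field_nth:
  "referred_field y V Ps m d r x $ Inl i = freqs x $ i - freqs x $ r"
  "referred_field y V Ps m d r x $ Inr i =
     (Ps $ i - Pe y V (angles x) $ i - d $ i * freqs x $ i) / m $ i"
  by (simp_all add: referred_field_def microgrid_field_def refer_to_def state_def angles_def freqs_def)


section \<open>The Jacobian in block form\<close>

definition Pe_jacobian :: "complex^'n^'n \<Rightarrow> real^'n \<Rightarrow> real^'n \<Rightarrow> real^'n^'n" where
  "Pe_jacobian y V \<delta> = (\<chi> i k.
     if i = k then (\<Sum>l\<in>UNIV - {i}. V $ i * V $ l * Ymod y i l * sin (Yarg y i l - \<delta> $ i + \<delta> $ l))
     else - (V $ i * V $ k * Ymod y i k * sin (Yarg y i k - \<delta> $ i + \<delta> $ k)))"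

definition block_jacobian ::
  "complex^'n^'n \<Rightarrow> real^'n \<Rightarrow> real^'n \<Rightarrow> real^'n \<Rightarrow> real^('n + 'n) \<Rightarrow> real^('n + 'n)^('n + 'n)" where
  "block_jacobian y V m d x = (\<chi> s t. case (s, t) of
       (Inl i, Inl k) \<Rightarrow> 0
     | (Inl i, Inr k) \<Rightarrow> (if i = k then 1 else 0)
     | (Inr i, Inl k) \<Rightarrow> - Pe_jacobian y V (angles x) $ i $ k / m $ i
     | (Inr i, Inr k) \<Rightarrow> (if i = k then - d $ i / m $ i else 0))"

lemma has_derivative_vec_nthI:
  fixes f :: "'a::real_normed_vector \<Rightarrow> real^'b"
  assumes "\<And>i. ((\<lambda>x. f x $ i) has_derivative (\<lambda>h. f' h $ i)) (at a)"
  shows "(f has_derivative f') (at a)"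
  using assms
  by (subst has_derivative_componentwise_within) (auto simp: Basis_vec_def inner_axis)

lemma sum_UNIV_Plus:
  "(\<Sum>s\<in>(UNIV :: ('n::finite + 'n) set). f s) = (\<Sum>i\<in>UNIV. f (Inl i)) + (\<Sum>i\<in>UNIV. f (Inr i))"
  by (simp add: UNIV_Plus_UNIV[symmetric] sum.Plus del: UNIV_Plus_UNIV)

lemma Pe_jacobian_mult:
  "(Pe_jacobian y V \<delta> *v h) $ i =
     (\<Sum>k\<in>UNIV. V $ i * V $ k * Ymod y i k * sin (Yarg y i k - \<delta> $ i + \<delta> $ k) * (h $ i - h $ k))"
proof -
  let ?w = "\<lambda>k. V $ i * V $ k * Ymod y i k * sin (Yarg y i k - \<delta> $ i + \<delta> $ k)"
  have "(Pe_jacobian y V \<delta> *v h) $ i =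
      (\<Sum>l\<in>UNIV - {i}. ?w l) * h $ i + (\<Sum>k\<in>UNIV - {i}. - ?w k * h $ k)"
    by (simp add: matrix_vector_mult_def Pe_jacobian_def sum.remove[of UNIV i])
  also have "\<dots> = (\<Sum>k\<in>UNIV - {i}. ?w k * (h $ i - h $ k))"
    by (simp add: sum_distrib_right right_diff_distrib sum_subtractf sum_negf)
  also have "\<dots> = (\<Sum>k\<in>UNIV. ?w k * (h $ i - h $ k))"
    by (simp add: sum.remove[of UNIV i])
  finally show ?thesis .
qed

lemma has_derivative_microgrid_field:
  fixes x :: "real^('n::finite + 'n)"
  shows "(microgrid_field y V Ps m d has_derivative (\<lambda>h. block_jacobian y V m d x *v h)) (at x)"
proof (rule has_derivative_vec_nthI)
  fix s :: "'n + 'n"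
  have nth: "((\<lambda>x. x $ t) has_derivative (\<lambda>h. h $ t)) (at x)" for t :: "'n + 'n"
    by (intro bounded_linear_imp_has_derivative bounded_linear_vec_nth)
  show "((\<lambda>x. microgrid_field y V Ps m d x $ s) has_derivative
          (\<lambda>h. (block_jacobian y V m d x *v h) $ s)) (at x)"
  proof (cases s)
    case (Inl i)
    have "(block_jacobian y V m d x *v h) $ s = h $ Inr i" for h
      by (simp add: Inl matrix_vector_mult_def block_jacobian_def sum_UNIV_Plus if_distrib if_distribR
          cong: if_cong)
    then show ?thesis
      using nth[of "Inr i"] by (simp add: Inl microgrid_field_def state_def freqs_def)
  next
    case (Inr i)
    let ?w = "\<lambda>k. V $ i * V $ k * Ymod y i k * sin (Yarg y i k - x $ Inl i + x $ Inl k)"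
    have eq: "(block_jacobian y V m d x *v h) $ s =
        (- (\<Sum>k\<in>UNIV. ?w k * (h $ Inl i - h $ Inl k)) - d $ i * h $ Inr i) * inverse (m $ i)" for h
    proof -
      have "(block_jacobian y V m d x *v h) $ s =
          (- (Pe_jacobian y V (angles x) *v angles h) $ i - d $ i * h $ Inr i) * inverse (m $ i)"
        by (simp add: Inr matrix_vector_mult_def block_jacobian_def sum_UNIV_Plus if_distrib
            if_distribR angles_def divide_inverse sum_distrib_left sum_negf algebra_simps cong: if_cong)
      then show ?thesis
        by (simp add: Pe_jacobian_mult angles_def)
    qed
    have "((\<lambda>x. (Ps $ i - (\<Sum>k\<in>UNIV. V $ i * V $ k * Ymod y i k *
            cos (Yarg y i k - x $ Inl i + x $ Inl k)) - d $ i * x $ Inr i) * inverse (m $ i))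
        has_derivative (\<lambda>h. (block_jacobian y V m d x *v h) $ s)) (at x)"
      unfolding eq
      by (rule derivative_eq_intros nth refl)+
         (simp add: algebra_simps sum_negf sum_subtractf sum.distrib)
    then show ?thesis
      by (simp add: Inr microgrid_field_def state_def freqs_def angles_def Pe_def divide_inverse)
  qed
qed

lemma jacobian_microgrid_field:
  "jacobian (microgrid_field y V Ps m d) (at x) = block_jacobian y V m d x"
  using frechet_derivative_at[OF has_derivative_microgrid_field[of y V Ps m d x], symmetric]
  by (simp add: jacobian_def)

end

theory Submission
  imports Defs "HOL-Computational_Algebra.Fundamental_Theorem_Algebra"
begin

text \<open>
  An eigenvector of \<open>J\<close> for \<open>\<mu>\<close> has angle part \<open>a\<close> with \<open>(M \<mu>\<^sup>2 + D \<mu> + L) a = 0\<close>. In a row \<open>i\<close> where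
  \<open>\<bar>a\<^sub>i\<bar>\<close> is maximal this gives \<open>\<bar>m\<^sub>i \<mu>\<^sup>2 + d\<^sub>i \<mu> + L\<^sub>i\<^sub>i\<bar> \<le> L\<^sub>i\<^sub>i\<close>, which the damping condition
  \<open>L\<^sub>i\<^sub>i \<le> d\<^sub>i\<^sup>2 / (2 m\<^sub>i)\<close> excludes for \<open>\<mu> \<noteq> 0\<close> in the closed right half plane. By connectedness and the
  maximum principle, referring the angles to a bus removes the eigenvalue \<open>0\<close>.

  For a Hurwitz matrix \<open>A\<close>, let \<open>(A - l\<^sub>1) \<dots> (A - l\<^sub>k) = 0\<close> with eigenvalues \<open>l\<^sub>j\<close>. The partial products
  \<open>y\<^sub>j\<close> of the factors applied to a solution of \<open>x' = A x\<close> satisfy \<open>y\<^sub>j' = l\<^sub>j\<^sub>+\<^sub>1 y\<^sub>j + y\<^sub>j\<^sub>+\<^sub>1\<close>, so a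
  suitably weighted sum of the \<open>\<bar>y\<^sub>j\<bar>\<^sup>2\<close> is a quadratic Lyapunov function, which also works for
  the nonlinear system near the equilibrium.
\<close>

section \<open>Quadratic Lyapunov functions of Hurwitz matrices\<close>

text \<open>The vector p(A) v, evaluated by Horner's scheme. Acting on vectors means that only
  products of \<open>A\<close> with vectors occur, and the later factorization arguments need
  nothing more.\<close>

definition poly_act :: "complex^'n^'n \<Rightarrow> complex poly \<Rightarrow> complex^'n \<Rightarrow> complex^'n" where
  "poly_act A p v = fold_coeffs (\<lambda>a w. a *s v + A *v w) p 0"

lemma poly_act_0 [simp]: "poly_act A 0 v = 0"
  by (simp add: poly_act_def)

lemma poly_act_pCons [simp]: "poly_act A (pCons a p) v = a *s v + A *v poly_act A p v"
  by (cases "a = 0 \<and> p = 0") (auto simp: poly_act_def)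

lemma poly_act_add: "poly_act A (p + q) v = poly_act A p v + poly_act A q v"
  by (induction p q rule: poly_induct2) (simp_all add: vector_sadd_rdistrib matrix_vector_right_distrib)

lemma poly_act_smult: "poly_act A (smult c p) v = c *s poly_act A p v"
  by (induction p) (simp_all add: vector_add_ldistrib vector_smult_assoc vector_scalar_commute)

lemma poly_act_linear_factor:
  "poly_act A ([:- z, 1:] * q) v = A *v poly_act A q v - z *s poly_act A q v"
proof -
  have "[:- z, 1:] * q = smult (- z) q + pCons 0 q" by simp
  then show ?thesis
    by (simp only: poly_act_add poly_act_smult poly_act_pCons) simp
qed

lemma poly_act_commute:
  "poly_act A q (A *v v - z *s v) = A *v poly_act A q v - z *s poly_act A q v"
proof (induction q)
  case (pCons a q)
  have "a *s (A *v v - z *s v) = A *v (a *s v) - z *s (a *s v)"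
    by (simp add: vector_ssub_ldistrib vector_smult_assoc vector_scalar_commute mult.commute)
  with pCons.IH show ?case
    by (simp add: matrix_vector_right_distrib matrix_vector_mult_diff_distrib vector_scalar_commute
        vector_add_ldistrib)
qed simp

lemma poly_act_sum: "poly_act A (\<Sum>i\<in>I. p i) v = (\<Sum>i\<in>I. poly_act A (p i) v)"
  by (induction I rule: infinite_finite_induct) (simp_all add: poly_act_add)

lemma poly_act_monom: "poly_act A (monom c k) v = c *s ((\<lambda>w. A *v w) ^^ k) v"
  by (induction k) (simp_all add: monom_0 monom_Suc vector_scalar_commute)

text \<open>The powers of \<open>A\<close> up to the real dimension N of the matrix space are N + 1
  elements, hence linearly dependent; the real coefficients of a dependence give the
  polynomial.\<close>

lemma annihilating_polynomial_exists:
  fixes A :: "complex^'n^'n"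
  obtains p where "p \<noteq> 0" "\<And>v. poly_act A p v = 0"
proof -
  define f where "f k = ((\<lambda>M. A ** M) ^^ k) (mat 1)" for k
  define N where "N = DIM(complex^'n^'n)"
  have fv: "f k *v v = ((\<lambda>w. A *v w) ^^ k) v" for k v
    by (induction k) (simp_all add: f_def matrix_vector_mul_assoc[symmetric])
  show ?thesis
  \<comment> \<open>Dependence is a property of the set of powers, so a repetition among them is
    treated first: if the powers i and j agree, the difference of the two monomials
    annihilates.\<close>
  proof (cases "inj_on f {..N}")
    case False
    then obtain i j where ij: "i \<noteq> j" "f i = f j"
      by (auto simp: inj_on_def)
    have "monom 1 i - monom (1::complex) j \<noteq> 0"
      using ij by (auto simp: poly_eq_iff)
    moreover have "poly_act A (monom 1 i - monom 1 j) v = 0" for v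
    proof -
      have "monom 1 i - monom 1 j = monom 1 i + smult (-1) (monom (1::complex) j)"
        by simp
      then show ?thesis
        using ij fv by (simp only: poly_act_add poly_act_smult poly_act_monom) (metis add.right_inverse scalar_mult_eq_scaleR vector_smult_lid vector_smult_lneg)
    qed
    ultimately show ?thesis by (rule that)
  next
    case True
    have "dependent (f ` {..N})"
    proof (rule dependent_biggerset)
      have "card (f ` {..N}) = Suc N"
        using card_image[OF True] by simp
      then show "DIM(complex^'n^'n) < card (f ` {..N})"
        unfolding N_def by (metis lessI)
    qed
    then obtain u where u: "\<exists>M\<in>f ` {..N}. u M \<noteq> 0" "(\<Sum>M\<in>f ` {..N}. u M *\<^sub>R M) = 0"
      by (subst (asm) dependent_finite) auto
    define c where "c k = complex_of_real (u (f k))" for k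
    have sum0: "(\<Sum>k\<le>N. u (f k) *\<^sub>R f k) = 0"
      using u(2) by (simp add: sum.reindex[OF True])
    define p where "p = (\<Sum>k\<le>N. monom (c k) k)"
    have "coeff p k = (if k \<le> N then c k else 0)" for k
      by (simp add: p_def coeff_sum if_distrib cong: if_cong)
    then have "p \<noteq> 0"
      using u(1) by (auto simp: poly_eq_iff c_def)
    moreover have "poly_act A p v = 0" for v
    proof -
      have lin: "linear (\<lambda>M. M *v v)"
        by (rule linearI) (simp_all add: matrix_vector_mult_add_rdistrib vec_eq_iff
            matrix_vector_mult_def scaleR_sum_right distrib_right sum.distrib)
      have "poly_act A p v = (\<Sum>k\<le>N. c k *s (f k *v v))"
        by (simp add: p_def poly_act_sum poly_act_monom fv)
      also have "\<dots> = (\<Sum>k\<le>N. u (f k) *\<^sub>R f k) *v v"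
        by (simp add: linear_sum[OF lin] linear_cmul[OF lin] c_def)
           (simp add: vec_eq_iff complex_eq_iff)
      finally show ?thesis by (simp add: sum0)
    qed
    ultimately show ?thesis by (rule that)
  qed
qed

text \<open>The product of the factors A - l applied to a vector. The head of the list acts first,
  so peeling it off leaves the same product for the tail, applied to the next partial
  product.\<close>

definition shifts :: "complex^'n^'n \<Rightarrow> complex list \<Rightarrow> complex^'n \<Rightarrow> complex^'n" where
  "shifts A ls = fold (\<lambda>l w. A *v w - l *s w) ls"

lemma shifts_simps [simp]:
  "shifts A [] v = v"
  "shifts A (l # ls) v = shifts A ls (A *v v - l *s v)"
  by (simp_all add: shifts_def)

text \<open>Split off the roots of p one at a time. A root z that is an eigenvalue stays in the
  list; for any other root A - z is injective, so dropping the factor does not change the kernel of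
  p(A). Hence only eigenvalues remain.\<close>

lemma shifts_annihilate_kernel:
  fixes A :: "complex^'n^'n"
  assumes "p \<noteq> 0"
  shows "\<exists>ls. (\<forall>l\<in>set ls. \<exists>v. v \<noteq> 0 \<and> A *v v = l *s v) \<and>
              (\<forall>v. poly_act A p v = 0 \<longrightarrow> shifts A ls v = 0)"
  using assms
proof (induction "degree p" arbitrary: p)
  case 0
  then obtain c where "p = [:c:]" "c \<noteq> 0"
    by (metis degree_eq_zeroE pCons_0_0)
  then show ?case
    by (intro exI[of _ "[]"]) (simp add: vector_mul_eq_0)
next
  case (Suc n)
  then obtain z where "poly p z = 0"
    using fundamental_theorem_of_algebra[of p] constant_degree[of p] by auto
  then obtain q where p: "p = [:- z, 1:] * q"
    by (auto simp: poly_eq_0_iff_dvd)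
  then have q: "q \<noteq> 0" using Suc.prems by auto
  have "degree p = Suc (degree q)"
    unfolding p using q by (subst degree_mult_eq) auto
  then obtain ls where ls: "\<forall>l\<in>set ls. \<exists>v. v \<noteq> 0 \<and> A *v v = l *s v"
      "\<And>v. poly_act A q v = 0 \<Longrightarrow> shifts A ls v = 0"
    using Suc.hyps(1)[of q] Suc.hyps(2) q by auto
  show ?case
  proof (cases "\<exists>v. v \<noteq> 0 \<and> A *v v = z *s v")
    case True
    have "shifts A (z # ls) v = 0" if "poly_act A p v = 0" for v
      using that ls(2)[of "A *v v - z *s v"]
      by (simp only: p poly_act_linear_factor poly_act_commute shifts_simps)
    with True ls(1) show ?thesis
      by (intro exI[of _ "z # ls"]) simp
  next
    case False
    have "shifts A ls v = 0" if "poly_act A p v = 0" for v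
    proof -
      have "A *v poly_act A q v = z *s poly_act A q v"
        using that by (simp only: p poly_act_linear_factor) simp
      with False have "poly_act A q v = 0" by blast
      then show ?thesis by (rule ls(2))
    qed
    with ls(1) show ?thesis by blast
  qed
qed

lemma annihilating_shifts_exist:
  fixes A :: "complex^'n^'n"
  obtains ls where "\<And>l. l \<in> set ls \<Longrightarrow> \<exists>v. v \<noteq> 0 \<and> A *v v = l *s v" "\<And>v. shifts A ls v = 0"
proof -
  obtain p where "p \<noteq> 0" "\<And>v. poly_act A p v = 0"
    by (rule annihilating_polynomial_exists[of A]) blast
  with shifts_annihilate_kernel[of p A] that show ?thesis by metis
qed

text \<open>The inner product on complex vectors is the real part of the Hermitian one, so the
  imaginary part of l contributes a rotation orthogonal to v.\<close>

lemma inner_cvec_scalar_mult: "inner (v::complex^'n) (l *s v) = Re l * inner v v"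
proof -
  have "inner z (l * z) = Re l * inner z z" for z :: complex
    by (simp add: inner_complex_def algebra_simps)
  then show ?thesis
    by (simp add: inner_vec_def sum_distrib_left)
qed

text \<open>Carrying the fully shifted vector as an error term lets the induction start with the
  zero form and the empty list. For an annihilating list the error vanishes and a Lyapunov form is
  left.\<close>

lemma lyapunov_form_of_shifts:
  fixes A :: "complex^'n^'n"
  assumes "\<And>l. l \<in> set ls \<Longrightarrow> Re l < 0"
  shows "\<exists>B c K. bounded_bilinear B \<and> c > 0 \<and> K \<ge> 0 \<and>
    (\<forall>x y. B x y = (B y x :: real)) \<and> (\<forall>x. 0 \<le> B x x) \<and>
    (\<forall>x. (norm x)\<^sup>2 \<le> B x x + (norm (shifts A ls x))\<^sup>2) \<and>
    (\<forall>x. B x (A *v x) \<le> - c * B x x + K * (norm (shifts A ls x))\<^sup>2)"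
  using assms
proof (induction ls)
  case Nil
  have "bounded_bilinear (\<lambda>(x::complex^'n) (y::complex^'n). 0::real)"
    by (simp add: bilinear_conv_bounded_bilinear[symmetric] bilinear_def linear_iff)
  then show ?case
    by (intro exI[of _ "\<lambda>_ _. 0"] exI[of _ 1] exI[of _ 0]) simp
next
  case (Cons l ls)
  then obtain B c K where B: "bounded_bilinear B" and c: "c > 0" and K: "K \<ge> 0"
    and sym: "\<And>x y. B x y = B y x" and nonneg: "\<And>x. 0 \<le> B x x"
    and low: "\<And>x. (norm x)\<^sup>2 \<le> B x x + (norm (shifts A ls x))\<^sup>2"
    and dec: "\<And>x. B x (A *v x) \<le> - c * B x x + K * (norm (shifts A ls x))\<^sup>2"
    by (metis list.set_intros(2))
  interpret B: bounded_bilinear B by (rule B)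
  define a where "a = - Re l"
  have a: "a > 0" using Cons.prems[of l] by (simp add: a_def)
  define S where "S x = A *v x - l *s x" for x
  \<comment> \<open>Young's inequality below costs b / (2 a), where b is the old form at
    \<open>S x\<close>. The old form decays by t * c * b = b / a, so this weight leaves half of that
    decay.\<close>
  define t where "t = 1 / (a * c)"
  have t: "t > 0" using a c by (simp add: t_def)
  define B' where "B' x y = inner x y + t * B (S x) (S y)" for x y
  define c' where "c' = min (a / 2) (c / 2)"
  define K' where "K' = 1 / (2 * a) + t * K"
  have S_lin: "linear S"
    by (rule linearI)
       (simp_all add: S_def matrix_vector_right_distrib vector_add_ldistrib algebra_simps
         linear_cmul[OF matrix_vector_mul_linear] vec_eq_iff)
  \<comment> \<open>Since S commutes with \<open>A\<close>, the induction hypothesis at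
    \<open>S x\<close> bounds the second summand of the new form.\<close>
  have S_A: "S (A *v x) = A *v S x" for x
    by (simp add: S_def matrix_vector_mult_diff_distrib vector_scalar_commute)
  have "bilinear B'"
    unfolding bilinear_def linear_iff B'_def
    by (simp add: linear_add[OF S_lin] linear_cmul[OF S_lin] B.add_left B.add_right
        B.scaleR_left B.scaleR_right inner_add_left inner_add_right algebra_simps)
  then have "bounded_bilinear B'"
    by (simp add: bilinear_conv_bounded_bilinear)
  moreover have "c' > 0" using a c by (simp add: c'_def)
  moreover have "K' \<ge> 0" using a t K by (simp add: K'_def)
  moreover have "B' x y = B' y x" for x y
    by (simp add: B'_def sym inner_commute)
  moreover have ge: "(norm x)\<^sup>2 \<le> B' x x" for x
    using t nonneg[of "S x"] by (simp add: B'_def power2_norm_eq_inner)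
  moreover have "0 \<le> B' x x" for x
    using ge[of x] by (meson order_trans zero_le_power2)
  moreover have "B' x (A *v x) \<le> - c' * B' x x + K' * (norm (shifts A (l # ls) x))\<^sup>2" for x
  proof -
    define n where "n = (norm (shifts A ls (S x)))\<^sup>2"
    define b where "b = B (S x) (S x)"
    have "inner x (A *v x) = inner x (S x) + inner x (l *s x)"
      by (simp add: S_def inner_diff_right)
    also have "\<dots> = inner x (S x) - a * (norm x)\<^sup>2"
      by (simp add: inner_cvec_scalar_mult a_def power2_norm_eq_inner)
    \<comment> \<open>Young's inequality, weighted so that half of the decay a |x|^2
      survives.\<close>
    also have "inner x (S x) \<le> a / 2 * (norm x)\<^sup>2 + 1 / (2 * a) * (norm (S x))\<^sup>2"
    proof -
      have "0 \<le> (a * norm x - norm (S x))\<^sup>2" by simp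
      then have "2 * a * (norm x * norm (S x)) \<le> a\<^sup>2 * (norm x)\<^sup>2 + (norm (S x))\<^sup>2"
        by (simp add: power2_eq_square algebra_simps)
      then have "norm x * norm (S x) \<le> a / 2 * (norm x)\<^sup>2 + 1 / (2 * a) * (norm (S x))\<^sup>2"
        using a by (simp add: field_simps power2_eq_square)
      with norm_cauchy_schwarz[of x "S x"] show ?thesis by linarith
    qed
    also have "(norm (S x))\<^sup>2 \<le> b + n"
      using low[of "S x"] by (simp add: b_def n_def)
    finally have 1: "inner x (A *v x) \<le> - (a / 2) * (norm x)\<^sup>2 + 1 / (2 * a) * (b + n)"
      using a by (simp add: divide_right_mono)
    have "t * B (S x) (S (A *v x)) \<le> t * (- c * b + K * n)"
      using dec[of "S x"] t by (simp add: S_A b_def n_def)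
    with 1 have "B' x (A *v x) \<le>
        - (a / 2) * (norm x)\<^sup>2 + 1 / (2 * a) * (b + n) + t * (- c * b + K * n)"
      by (simp add: B'_def)
    also have "\<dots> = - (a / 2) * (norm x)\<^sup>2 - (c / 2) * (t * b) + K' * n"
      using a c by (simp add: K'_def t_def field_simps)
    also have "\<dots> \<le> - c' * (norm x)\<^sup>2 - c' * (t * b) + K' * n"
    proof -
      have "c' * (norm x)\<^sup>2 \<le> (a / 2) * (norm x)\<^sup>2" "c' * (t * b) \<le> (c / 2) * (t * b)"
        using t nonneg[of "S x"] by (rule_tac mult_right_mono; simp add: c'_def b_def)+
      then show ?thesis by linarith
    qed
    also have "\<dots> = - c' * B' x x + K' * n"
      by (simp add: B'_def b_def power2_norm_eq_inner algebra_simps)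
    finally show ?thesis by (simp add: n_def S_def)
  qed
  ultimately show ?case
    by (intro exI[of _ B'] exI[of _ c'] exI[of _ K']) (auto intro: add_increasing2)
qed

theorem lyapunov_form_exists:
  fixes A :: "real^'n^'n"
  assumes hurwitz: "\<And>\<mu>. complex_eigenvalue A \<mu> \<Longrightarrow> Re \<mu> < 0"
  obtains B :: "real^'n \<Rightarrow> real^'n \<Rightarrow> real" and c where "bounded_bilinear B" "c > 0"
    "\<And>x y. B x y = B y x" "\<And>x. (norm x)\<^sup>2 \<le> B x x" "\<And>x. B x (A *v x) \<le> - c * B x x"
proof -
  let ?A = "map_matrix of_real A :: complex^'n^'n"
  \<comment> \<open>The form is built for the complexified matrix and pulled back along this
    isometric embedding, which intertwines \<open>A\<close> with its complexification.\<close>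
  define C where "C x = (\<chi> i. complex_of_real (x $ i))" for x :: "real^'n"
  obtain ls where ls: "\<And>l. l \<in> set ls \<Longrightarrow> \<exists>v. v \<noteq> 0 \<and> ?A *v v = l *s v"
      "\<And>v. shifts ?A ls v = 0"
    by (rule annihilating_shifts_exist[of ?A]) blast
  have "Re l < 0" if "l \<in> set ls" for l
    using hurwitz[of l] ls(1)[OF that] by (simp add: complex_eigenvalue_def)
  from lyapunov_form_of_shifts[of ls ?A, OF this]
  obtain B c where B: "bounded_bilinear B" and c: "c > 0" and sym: "\<And>x y. B x y = B y x"
    and low: "\<And>x. (norm x)\<^sup>2 \<le> B x x" and dec: "\<And>x. B x (?A *v x) \<le> - c * B x x"
    by (auto simp: ls(2))
  have norm_C: "norm (C x) = norm x" for x
    by (simp add: C_def norm_vec_def)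
  have C_lin: "linear C"
    by (rule linearI) (simp_all add: C_def vec_eq_iff scaleR_complex.ctr complex_eq_iff)
  then have C_blin: "bounded_linear C" by (simp add: linear_conv_bounded_linear)
  have C_mult: "C (A *v x) = ?A *v C x" for x
    by (simp add: C_def vec_eq_iff matrix_vector_mult_def map_matrix_def)
  show ?thesis
  proof (rule that)
    show "bounded_bilinear (\<lambda>x y. B (C x) (C y))"
      by (rule bounded_bilinear.comp[OF B C_blin C_blin])
    show "c > 0" by (rule c)
    show "B (C x) (C y) = B (C y) (C x)" for x y by (rule sym)
    show "(norm x)\<^sup>2 \<le> B (C x) (C x)" for x using low[of "C x"] by (simp add: norm_C)
    show "B (C x) (C (A *v x)) \<le> - c * B (C x) (C x)" for x using dec[of "C x"] by (simp add: C_mult)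
  qed
qed

section \<open>Stability by linearization\<close>

lemma solves_ode_in_DERIV:
  assumes "solves_ode_in X f x" "t > 0"
  shows "(x has_vector_derivative f (x t)) (at t)"
proof -
  have "(x has_vector_derivative f (x t)) (at t within {0..})"
    using assms by (simp add: solves_ode_in_def)
  moreover have "at t within {0..} = at t"
    using assms(2) by (intro at_within_interior) simp
  ultimately show ?thesis by simp
qed

lemma solves_ode_in_continuous:
  assumes "solves_ode_in X f x"
  shows "continuous_on {0..} x"
  using assms unfolding solves_ode_in_def continuous_on_eq_continuous_within
  by (auto intro: has_vector_derivative_continuous)

text \<open>Along a solution the quadratic function W has derivative at most -2 c W while W < R^2,
  because \<open>low\<close> places this sublevel set inside the ball where \<open>dec\<close>
  holds. Solutions starting in the sublevel set stay there, and W decays exponentially.\<close>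

lemma lyapunov_stability:
  fixes f :: "'a::euclidean_space \<Rightarrow> 'a" and B :: "'a \<Rightarrow> 'a \<Rightarrow> real"
  assumes B: "bounded_bilinear B" and sym: "\<And>u v. B u v = B v u"
    and low: "\<And>u. (norm u)\<^sup>2 \<le> B u u"
    and c: "c > 0" and R: "R > 0"
    and dec: "\<And>u. norm u < R \<Longrightarrow> B u (f (p + u)) \<le> - c * B u u"
  shows "\<forall>\<epsilon>>0. \<exists>\<rho>>0. \<forall>x. solves_ode_in X f x \<and> dist (x 0) p < \<rho> \<longrightarrow>
      (\<forall>t\<ge>0. dist (x t) p < \<epsilon>)"
    and "\<exists>\<rho>>0. \<forall>x. solves_ode_in X f x \<and> dist (x 0) p < \<rho> \<longrightarrow> (x \<longlongrightarrow> p) at_top"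
proof -
  interpret B: bounded_bilinear B by (rule B)
  obtain K where K: "K > 0" "\<And>u v. norm (B u v) \<le> norm u * norm v * K"
    using B.pos_bounded by blast
  define W where "W x t = B (x t - p) (x t - p)" for x :: "real \<Rightarrow> 'a" and t
  have W_deriv: "(W x has_real_derivative 2 * B (x t - p) (f (x t))) (at t)"
    if "solves_ode_in X f x" "t > 0" for x t
  proof -
    have "((\<lambda>t. x t - p) has_vector_derivative f (x t)) (at t)"
      using solves_ode_in_DERIV[OF that] by (auto intro!: derivative_eq_intros)
    from B.has_vector_derivative[OF this this]
    have "(W x has_vector_derivative 2 * B (x t - p) (f (x t))) (at t)"
      by (simp add: W_def[abs_def] sym[of "f (x t)"])
    then show ?thesis by (simp add: has_real_derivative_iff_has_vector_derivative)
  qed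
  have W_cont: "continuous_on S (W x)" if "solves_ode_in X f x" "S \<subseteq> {0..}" for x S
    unfolding W_def[abs_def]
    by (intro B.continuous_on continuous_intros continuous_on_subset[OF solves_ode_in_continuous that(2)])
       (rule that(1))+
  have W_dec: "2 * B (x t - p) (f (x t)) \<le> - (2 * c) * W x t" if "W x t < R\<^sup>2" for x t
  proof -
    have "(norm (x t - p))\<^sup>2 < R\<^sup>2"
      using low[of "x t - p"] that by (simp add: W_def)
    then have "norm (x t - p) < R" using R by (simp add: power_less_imp_less_base)
    from dec[OF this] show ?thesis by (simp add: W_def)
  qed
  have W_nonneg: "0 \<le> W x t" for x t
    using low[of "x t - p"] by (simp add: W_def) (meson order_trans zero_le_power2)
  have trapped: "W x t < r\<^sup>2" if x: "solves_ode_in X f x" and r: "r \<le> R" "0 < r" "W x 0 < r\<^sup>2" and t: "t \<ge> 0" for x t r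
  proof (rule ccontr)
    assume *: "\<not> W x t < r\<^sup>2"
    \<comment> \<open>The times up to t at which W has reached r^2. At the first of them, s, W is at
      least r^2, although W does not increase on the interval from 0 to s and starts below
      r^2.\<close>
    define S where "S = {0..t} \<inter> W x -` {r\<^sup>2..}"
    have "closed S" unfolding S_def
      by (intro continuous_closed_preimage W_cont[OF x]) auto
    moreover have "bounded S" by (rule bounded_subset[of "{0..t}"]) (auto simp: S_def)
    ultimately have "compact S" by (simp add: compact_eq_bounded_closed)
    moreover have "t \<in> S" using * t by (simp add: S_def)
    ultimately obtain s where s: "s \<in> S" "\<And>s'. s' \<in> S \<Longrightarrow> s \<le> s'"
      using compact_attains_inf[of S] by blast
    have below: "W x s' < r\<^sup>2" if "0 \<le> s'" "s' < s" for s'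
    proof -
      have "s' \<notin> S" using s(2)[of s'] that by auto
      then show ?thesis using s(1) that by (simp add: S_def)
    qed
    have "W x s \<le> W x 0"
    proof (rule DERIV_nonpos_imp_decreasing_open[of 0 s "W x"])
      show "0 \<le> s" using s(1) by (simp add: S_def)
      show "continuous_on {0..s} (W x)" by (rule W_cont[OF x]) auto
      fix s' assume s': "0 < s'" "s' < s"
      have "r\<^sup>2 \<le> R\<^sup>2" using r by (intro power_mono) auto
      then have "W x s' < R\<^sup>2" using below[of s'] s' by auto
      from W_dec[OF this] have "2 * B (x s' - p) (f (x s')) \<le> 0"
        using mult_nonneg_nonneg[OF less_imp_le[OF c] W_nonneg[of x s']] by linarith
      with W_deriv[OF x s'(1)] show "\<exists>y. DERIV (W x) s' :> y \<and> y \<le> 0" by blast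
    qed
    with s(1) r(3) show False by (simp add: S_def)
  qed
  \<comment> \<open>The bound B u u <= K |u|^2 turns a ball of radius r / sqrt K into part of the
    sublevel set.\<close>
  have start: "\<exists>\<rho>>0. \<forall>z. dist z p < \<rho> \<longrightarrow> B (z - p) (z - p) < r\<^sup>2" if "r > 0" for r
  proof (intro exI[of _ "r / sqrt K"] conjI allI impI)
    show "r / sqrt K > 0" using that K by simp
    fix z assume "dist z p < r / sqrt K"
    then have "(norm (z - p))\<^sup>2 < (r / sqrt K)\<^sup>2"
      by (intro power_strict_mono) (auto simp: dist_norm)
    then have "(norm (z - p))\<^sup>2 * K < r\<^sup>2"
      using K by (simp add: power_divide field_simps)
    moreover have "B (z - p) (z - p) \<le> (norm (z - p))\<^sup>2 * K"
      using K(2)[of "z - p" "z - p"] by (simp add: power2_eq_square)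
    ultimately show "B (z - p) (z - p) < r\<^sup>2" by linarith
  qed
  show "\<forall>\<epsilon>>0. \<exists>\<rho>>0. \<forall>x. solves_ode_in X f x \<and> dist (x 0) p < \<rho> \<longrightarrow>
      (\<forall>t\<ge>0. dist (x t) p < \<epsilon>)"
  proof (intro allI impI)
    fix \<epsilon> :: real assume \<epsilon>: "\<epsilon> > 0"
    \<comment> \<open>This sublevel set lies in the target ball and also in the region where W
      decreases.\<close>
    define r where "r = min \<epsilon> R"
    have r: "0 < r" "r \<le> R" "r \<le> \<epsilon>" using \<epsilon> R by (auto simp: r_def)
    obtain \<rho> where \<rho>: "\<rho> > 0" "\<And>x. dist (x 0) p < \<rho> \<Longrightarrow> W x 0 < r\<^sup>2"
      using start[OF r(1)] unfolding W_def by blast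
    have "dist (x t) p < \<epsilon>" if "solves_ode_in X f x" "dist (x 0) p < \<rho>" "t \<ge> 0" for x t
    proof -
      have "(norm (x t - p))\<^sup>2 < r\<^sup>2"
        using trapped[OF that(1) r(2,1) \<rho>(2)[of x, OF that(2)] that(3)] low[of "x t - p"]
        by (simp add: W_def)
      then have "norm (x t - p) < r" using r by (simp add: power_less_imp_less_base)
      with r show ?thesis by (simp add: dist_norm)
    qed
    with \<rho>(1) show "\<exists>\<rho>>0. \<forall>x. solves_ode_in X f x \<and> dist (x 0) p < \<rho> \<longrightarrow>
      (\<forall>t\<ge>0. dist (x t) p < \<epsilon>)" by blast
  qed
  show "\<exists>\<rho>>0. \<forall>x. solves_ode_in X f x \<and> dist (x 0) p < \<rho> \<longrightarrow> (x \<longlongrightarrow> p) at_top"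
  proof -
    obtain \<rho> where \<rho>: "\<rho> > 0" "\<And>x. dist (x 0) p < \<rho> \<Longrightarrow> W x 0 < R\<^sup>2"
      using start[OF R] unfolding W_def by blast
    have "(x \<longlongrightarrow> p) at_top" if x: "solves_ode_in X f x" and x0: "dist (x 0) p < \<rho>" for x
    proof -
      \<comment> \<open>Integrating factor: the differential inequality for W says that exp (2 c t)
        W does not increase.\<close>
      have decay: "exp (2 * c * t) * W x t \<le> exp (2 * c * 0) * W x 0" if t: "t \<ge> 0" for t
      proof (rule DERIV_nonpos_imp_decreasing_open[of 0 t "\<lambda>t. exp (2 * c * t) * W x t"])
        show "0 \<le> t" by (rule t)
        show "continuous_on {0..t} (\<lambda>t. exp (2 * c * t) * W x t)"
          by (intro continuous_intros W_cont[OF x]) auto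
        fix s :: real assume s: "0 < s" "s < t"
        have "((\<lambda>t. exp (2 * c * t) * W x t) has_real_derivative
            exp (2 * c * s) * (2 * c * W x s + 2 * B (x s - p) (f (x s)))) (at s)"
          by (auto intro!: derivative_eq_intros W_deriv[OF x s(1)] simp: algebra_simps)
        moreover have "2 * c * W x s + 2 * B (x s - p) (f (x s)) \<le> 0"
          using W_dec[OF trapped[OF x order_refl R \<rho>(2)[of x, OF x0], of s]] s by auto
        ultimately show "\<exists>y. ((\<lambda>t. exp (2 * c * t) * W x t) has_real_derivative y) (at s) \<and> y \<le> 0"
          by (meson exp_ge_zero mult_nonneg_nonpos)
      qed
      have "W x t \<le> exp (- (2 * c * t)) * W x 0" if "t \<ge> 0" for t
      proof -
        have "exp (- (2 * c * t)) * (exp (2 * c * t) * W x t) \<le> exp (- (2 * c * t)) * W x 0"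
          using decay[OF that] by (intro mult_left_mono) simp_all
        then show ?thesis by (simp add: mult.assoc[symmetric] exp_add[symmetric])
      qed
      moreover have "((\<lambda>t. exp (- (2 * c * t)) * W x 0) \<longlongrightarrow> 0) at_top"
        by (rule tendsto_mult_left_zero, rule filterlim_compose[OF exp_at_bot])
           (use c in \<open>auto simp: filterlim_uminus_at_bot intro!: filterlim_tendsto_pos_mult_at_top[OF tendsto_const] filterlim_ident\<close>)
      ultimately have W_lim: "(W x \<longlongrightarrow> 0) at_top"
        using W_nonneg
        by (intro tendsto_sandwich[of "\<lambda>_. 0" "W x" _ "\<lambda>t. exp (- (2 * c * t)) * W x 0"]
            eventually_mono[OF eventually_ge_at_top[of 0]] always_eventually allI tendsto_const)
      have "dist (x t) p \<le> sqrt (W x t)" for t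
        using low[of "x t - p"] by (simp add: W_def dist_norm real_le_rsqrt)
      moreover have "((\<lambda>t. sqrt (W x t)) \<longlongrightarrow> 0) at_top"
        using tendsto_real_sqrt[OF W_lim] by simp
      ultimately have "((\<lambda>t. dist (x t) p) \<longlongrightarrow> 0) at_top"
        by (intro tendsto_sandwich[of "\<lambda>_. 0" "\<lambda>t. dist (x t) p" _ "\<lambda>t. sqrt (W x t)"]
            always_eventually allI tendsto_const zero_le_dist)
      then show ?thesis by (subst tendsto_dist_iff)
    qed
    with \<rho>(1) show ?thesis by blast
  qed
qed

text \<open>The Lyapunov form of \<open>A\<close> still decays along \<open>f\<close> near
  \<open>p\<close>, since the linearization error is of smaller order. The Hurwitz condition is
  imposed on the whole space, also when \<open>X\<close> is a proper subspace; this is the reason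
  for the pinned field introduced later.\<close>

theorem asymptotically_stable_if_linearization_stable:
  fixes f :: "real^'n \<Rightarrow> real^'n" and A :: "real^'n^'n"
  assumes deriv: "(f has_derivative (\<lambda>h. A *v h)) (at p)" and fp: "f p = 0" and p: "p \<in> X"
    and hurwitz: "\<And>\<mu>. complex_eigenvalue A \<mu> \<Longrightarrow> Re \<mu> < 0"
    and ex: "\<And>x0. x0 \<in> X \<Longrightarrow> \<exists>x. solves_ode_in X f x \<and> x 0 = x0"
  shows "locally_asymptotically_stable X f p"
proof -
  obtain B :: "real^'n \<Rightarrow> real^'n \<Rightarrow> real" and c where B: "bounded_bilinear B" and c: "c > 0"
    and sym: "\<And>x y. B x y = B y x" and low: "\<And>x. (norm x)\<^sup>2 \<le> B x x"
    and dec: "\<And>x. B x (A *v x) \<le> - c * B x x"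
    by (rule lyapunov_form_exists[of A]) (erule hurwitz, rule that)
  interpret B: bounded_bilinear B by (rule B)
  obtain K where K: "K > 0" "\<And>u v. norm (B u v) \<le> norm u * norm v * K"
    using B.pos_bounded by blast
  \<comment> \<open>With this tolerance the linearization error contributes at most K e |u|^2 = (c /
    2) |u|^2, which is half of the decay.\<close>
  define e where "e = c / (2 * K)"
  have "e > 0" using c K by (simp add: e_def)
  then obtain R where R: "R > 0"
    "\<And>q. norm (q - p) < R \<Longrightarrow> norm (f q - f p - A *v (q - p)) \<le> e * norm (q - p)"
    using deriv by (auto simp: has_derivative_at_alt)
  have dec': "B u (f (p + u)) \<le> - (c / 2) * B u u" if u: "norm u < R" for u
  proof -
    define v where "v = f (p + u) - A *v u"
    have v: "norm v \<le> e * norm u"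
      using R(2)[of "p + u"] u fp by (simp add: v_def)
    have "B u v \<le> norm u * norm v * K"
      using K(2)[of u v] by simp
    also have "\<dots> \<le> norm u * (e * norm u) * K"
      using v K(1) by (intro mult_right_mono mult_left_mono) auto
    also have "\<dots> = (c / 2) * (norm u)\<^sup>2"
      using K(1) by (simp add: e_def power2_eq_square field_simps)
    also have "\<dots> \<le> (c / 2) * B u u"
      using c low by (intro mult_left_mono) auto
    finally have "B u v \<le> (c / 2) * B u u" .
    moreover have "B u (f (p + u)) = B u (A *v u) + B u v"
      by (simp add: v_def B.diff_right)
    ultimately show ?thesis using dec[of u] by simp
  qed
  have c2: "c / 2 > 0" using c by simp
  note lyapunov_stability[where B = B and f = f and p = p and X = X, OF B sym low c2 R(1) dec']
  moreover have "\<exists>\<rho>>0. \<forall>x0\<in>X. dist x0 p < \<rho> \<longrightarrow> (\<exists>x. solves_ode_in X f x \<and> x 0 = x0)"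
    using ex by (intro exI[of _ 1]) simp
  ultimately show ?thesis
    using p fp by (simp add: locally_asymptotically_stable_def)
qed

section \<open>Global solutions of Lipschitz equations\<close>

text \<open>
  In the variable \<open>g t = exp (- 2 L t) (x t - x\<^sub>0)\<close> the Picard operator is a contraction with factor
  \<open>1/2\<close> on all of \<open>[0, \<infinity>)\<close>, so that no local solutions have to be glued.
\<close>

lemma lipschitz_ode_global_solution:
  fixes f :: "'a::banach \<Rightarrow> 'a"
  assumes lip: "L-lipschitz_on UNIV f"
  obtains x where "solves_ode_in UNIV f x" "x 0 = x0"
proof -
  \<comment> \<open>A Lipschitz constant that is strictly positive even if L = 0, so that division
    by 2 M is possible.\<close>
  define M where "M = L + 1"
  have M: "M > 0" "L \<ge> 0" using lipschitz_on_nonneg[OF lip] by (simp_all add: M_def)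
  have lipM: "norm (f u - f v) \<le> M * norm (u - v)" for u v
    using lipschitz_on_normD[OF lip, of u v] mult_right_mono[of L M "norm (u - v)"]
    by (simp add: M_def)
  have f_cont: "continuous_on UNIV f" by (rule lipschitz_on_continuous_on[OF lip])
  define h where "h g s = f (x0 + exp (2 * M * s) *\<^sub>R apply_bcontfun g s)" for g :: "real \<Rightarrow>\<^sub>C 'a" and s
  \<comment> \<open>The Picard operator in the weighted variable. Bounded continuous functions live
    on the whole line, so negative times are sent to 0 by \<open>max\<close>.\<close>
  define T where "T g t = exp (- (2 * M * max 0 t)) *\<^sub>R integral {0..max 0 t} (h g)" for g :: "real \<Rightarrow>\<^sub>C 'a" and t
  have h_cont: "continuous_on S (h g)" for S g
    unfolding h_def by (intro continuous_on_compose2[OF f_cont] continuous_intros) auto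
  have h_int: "h g integrable_on {a..b}" for g a b
    by (intro integrable_continuous_real h_cont)
  have exp_int: "integral {0..t} (\<lambda>s. C * exp (2 * M * s)) \<le> C / (2 * M) * exp (2 * M * t)"
      (is "?I \<le> _") and exp_int': "(\<lambda>s. C * exp (2 * M * s)) integrable_on {0..t}"
    if "t \<ge> 0" "C \<ge> 0" for t C
  proof -
    have "((\<lambda>s. C * exp (2 * M * s)) has_integral
        (C / (2 * M) * exp (2 * M * t) - C / (2 * M) * exp (2 * M * 0))) {0..t}"
      using that M by (intro fundamental_theorem_of_calculus)
        (auto intro!: derivative_eq_intros simp: has_real_derivative_iff_has_vector_derivative[symmetric])
    moreover have "0 \<le> C / (2 * M)" using that M by simp
    ultimately show "?I \<le> C / (2 * M) * exp (2 * M * t)" "(\<lambda>s. C * exp (2 * M * s)) integrable_on {0..t}"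
      by (auto simp: integral_unique integrable_on_def simp del: integral_mult_right)
  qed
  \<comment> \<open>Used twice: with the growth constant of h it shows that T g is bounded, and with
    C = M * dist g k it yields the contraction factor 1/2.\<close>
  have bound: "norm (exp (- (2 * M * t)) *\<^sub>R integral {0..t} k) \<le> C / (2 * M)"
    if t: "t \<ge> 0" and C: "C \<ge> 0" and k: "k integrable_on {0..t}"
      "\<And>s. s \<in> {0..t} \<Longrightarrow> norm (k s) \<le> C * exp (2 * M * s)" for t C and k :: "real \<Rightarrow> 'a"
  proof -
    have "norm (integral {0..t} k) \<le> integral {0..t} (\<lambda>s. C * exp (2 * M * s))"
      by (rule integral_norm_bound_integral[OF k(1) exp_int'[OF t C] k(2)])
    also note exp_int[OF t C]
    finally have "exp (- (2 * M * t)) * norm (integral {0..t} k) \<le>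
        exp (- (2 * M * t)) * (C / (2 * M) * exp (2 * M * t))"
      by (intro mult_left_mono) auto
    then show ?thesis by (simp add: exp_minus field_simps)
  qed
  have "T g \<in> bcontfun" for g
  proof (rule bcontfun_normI)
    \<comment> \<open>Continuity of the indefinite integral holds on compact intervals; near t the
      interval up to t + 1 is enough.\<close>
    have "continuous_on {0..} (\<lambda>t. integral {0..t} (h g))"
      unfolding continuous_on_eq_continuous_within
    proof
      fix t :: real assume t: "t \<in> {0..}"
      have "continuous_on {0..t+1} (\<lambda>t. integral {0..t} (h g))"
        by (rule indefinite_integral_continuous_1[OF h_int])
      then have "continuous (at t within {0..t+1}) (\<lambda>t. integral {0..t} (h g))"
        using t by (auto simp: continuous_on_eq_continuous_within)
      moreover have "at t within {0..t+1} = at t within {0..}"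
        using t by (intro at_within_nhd[of _ "{..<t+1}"]) auto
      ultimately show "continuous (at t within {0..}) (\<lambda>t. integral {0..t} (h g))" by simp
    qed
    moreover have max_cont: "continuous_on UNIV (\<lambda>t::real. max 0 t)"
      by (intro continuous_intros)
    ultimately have "continuous_on UNIV (\<lambda>t. integral {0..max 0 t} (h g))"
      by (rule continuous_on_compose2[of "{0..}" "\<lambda>t. integral {0..t} (h g)" UNIV "\<lambda>t. max 0 t"]) auto
    then show "continuous_on UNIV (T g)"
      unfolding T_def by (intro continuous_intros)
    define C where "C = norm (f x0) + M * norm g"
    have C: "C \<ge> 0" using M by (simp add: C_def)
    fix t
    show "norm (T g t) \<le> C / (2 * M)"
      unfolding T_def
    proof (rule bound[OF _ C h_int])
      fix s :: real assume s: "s \<in> {0..max 0 t}"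
      have "norm (h g s) \<le> norm (f x0) + norm (h g s - f x0)"
        by (rule norm_triangle_sub)
      also have "norm (h g s - f x0) \<le> M * (exp (2 * M * s) * norm (apply_bcontfun g s))"
        using lipM[of "x0 + exp (2 * M * s) *\<^sub>R apply_bcontfun g s" x0] by (simp add: h_def)
      also have "\<dots> \<le> M * (exp (2 * M * s) * norm g)"
        using M by (intro mult_left_mono norm_bounded) auto
      also have "norm (f x0) \<le> norm (f x0) * exp (2 * M * s)"
        using s M by (simp add: mult_le_cancel_left1)
      finally show "norm (h g s) \<le> C * exp (2 * M * s)"
        by (simp add: C_def algebra_simps)
    qed simp
  qed
  then have T_apply: "apply_bcontfun (Bcontfun (T g)) = T g" for g
    by (simp add: Bcontfun_inverse)
  have "\<exists>!g. Bcontfun (T g) = g"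
  proof (rule banach_fix_type[of "1/2"])
    show "\<forall>g k. dist (Bcontfun (T g)) (Bcontfun (T k)) \<le> 1 / 2 * dist g k"
    proof (intro allI dist_bound)
      fix g k t
      have "T g t - T k t = exp (- (2 * M * max 0 t)) *\<^sub>R integral {0..max 0 t} (\<lambda>s. h g s - h k s)"
        by (simp add: T_def integral_diff[OF h_int h_int] scaleR_diff_right)
      also have "norm \<dots> \<le> M * dist g k / (2 * M)"
      proof (rule bound)
        show "(\<lambda>s. h g s - h k s) integrable_on {0..max 0 t}"
          by (intro integrable_diff h_int)
        fix s :: real
        have "norm (h g s - h k s) \<le> M * (exp (2 * M * s) * dist (apply_bcontfun g s) (apply_bcontfun k s))"
          using lipM[of "x0 + exp (2 * M * s) *\<^sub>R apply_bcontfun g s" "x0 + exp (2 * M * s) *\<^sub>R apply_bcontfun k s"]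
          by (simp add: h_def dist_norm scaleR_diff_right[symmetric])
        also have "\<dots> \<le> M * (exp (2 * M * s) * dist g k)"
          using M by (intro mult_left_mono dist_bounded) auto
        finally show "norm (h g s - h k s) \<le> M * dist g k * exp (2 * M * s)"
          by (simp add: algebra_simps)
      qed (use M in auto)
      finally show "dist (apply_bcontfun (Bcontfun (T g)) t) (apply_bcontfun (Bcontfun (T k)) t) \<le> 1 / 2 * dist g k"
        using M by (simp add: T_apply dist_norm)
    qed
  qed auto
  then obtain g where "Bcontfun (T g) = g" by blast
  then have g: "apply_bcontfun g = T g" using T_apply[of g] by simp
  define x where "x t = x0 + exp (2 * M * t) *\<^sub>R apply_bcontfun g t" for t
  have hx: "h g s = f (x s)" for s by (simp add: h_def x_def)
  have x_eq: "x t = x0 + integral {0..t} (h g)" if "t \<ge> 0" for t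
    using that by (simp add: x_def g T_def exp_minus)
  have "(x has_vector_derivative f (x t)) (at t within {0..})" if t: "t \<ge> 0" for t
  proof -
    have "((\<lambda>t. integral {0..t} (h g)) has_vector_derivative f (x t)) (at t within {0..t+1})"
      using integral_has_vector_derivative[OF h_cont, of t 0 "t+1" g] t by (simp add: hx)
    then have "((\<lambda>t. x0 + integral {0..t} (h g)) has_vector_derivative f (x t)) (at t within {0..t+1})"
      by (auto intro!: derivative_eq_intros)
    moreover have "at t within {0..t+1} = at t within {0..}"
      using t by (intro at_within_nhd[of _ "{..<t+1}"]) auto
    ultimately have "((\<lambda>t. x0 + integral {0..t} (h g)) has_vector_derivative f (x t)) (at t within {0..})"
      by simp
    then show ?thesis
      by (rule has_vector_derivative_transform[rotated 2]) (use t x_eq in auto)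
  qed
  then have "solves_ode_in UNIV f x" by (simp add: solves_ode_in_def)
  moreover have "x 0 = x0" by (simp add: x_eq)
  ultimately show ?thesis by (rule that)
qed

section \<open>Lipschitz bounds for vectors, sums and the cosine\<close>

lemma lipschitz_on_vec:
  fixes f :: "'a::metric_space \<Rightarrow> real^'n"
  assumes "\<And>i. \<exists>L. L-lipschitz_on S (\<lambda>x. f x $ i)"
  shows "\<exists>L. L-lipschitz_on S f"
proof -
  obtain L :: "'n \<Rightarrow> real" where L: "\<And>i. (L i)-lipschitz_on S (\<lambda>x. f x $ i)"
    using assms by metis
  have "(\<Sum>i\<in>UNIV. L i)-lipschitz_on S f"
  proof (rule lipschitz_onI)
    fix x y assume xy: "x \<in> S" "y \<in> S"
    have "dist (f x) (f y) \<le> (\<Sum>i\<in>UNIV. \<bar>(f x - f y) $ i\<bar>)"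
      unfolding dist_norm by (rule norm_le_l1_cart)
    also have "\<dots> \<le> (\<Sum>i\<in>UNIV. L i * dist x y)"
      using lipschitz_onD[OF L xy] by (intro sum_mono) (simp add: dist_real_def)
    finally show "dist (f x) (f y) \<le> (\<Sum>i\<in>UNIV. L i) * dist x y"
      by (simp add: sum_distrib_right)
  qed (auto intro: sum_nonneg lipschitz_on_nonneg[OF L])
  then show ?thesis ..
qed

lemma lipschitz_on_sum:
  fixes f :: "'i \<Rightarrow> 'a::metric_space \<Rightarrow> 'b::real_normed_vector"
  assumes "\<And>i. i \<in> I \<Longrightarrow> \<exists>L. L-lipschitz_on S (f i)"
  shows "\<exists>L. L-lipschitz_on S (\<lambda>x. \<Sum>i\<in>I. f i x)"
  using assms
proof (induction I rule: infinite_finite_induct)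
  case (insert i I)
  then obtain L M where "L-lipschitz_on S (f i)" "M-lipschitz_on S (\<lambda>x. \<Sum>i\<in>I. f i x)"
    by (metis insertCI)
  from lipschitz_on_add[OF this] insert.hyps show ?case by auto
qed (auto intro: lipschitz_on_constant)

lemma lipschitz_on_cos: "1-lipschitz_on UNIV (cos :: real \<Rightarrow> real)"
  by (rule bounded_derivative_imp_lipschitz[where f' = "\<lambda>x h. - sin x * h"])
     (auto intro!: derivative_eq_intros onorm_le simp: onorm_le abs_mult mult_left_le_one_le)

lemma lipschitz_on_vec_nth: "1-lipschitz_on S (\<lambda>x::real^'n. x $ i)"
  by (rule lipschitz_onI) (simp_all add: dist_vec_nth_le)

section \<open>Spectrum of damped networks\<close>

text \<open>With \<open>\<mu>\<close> = a + i b, expand the squared modulus minus s^2. For a >= 0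
  the only negative term is -2 s m b^2, which the damping bound makes no larger than d^2 b^2; the
  term m^2 |\<open>\<mu>\<close>|^4 makes the inequality strict.\<close>

lemma damped_oscillator_gain:
  fixes m d s :: real and \<mu> :: complex
  assumes m: "m > 0" and d: "d > 0" and s: "0 \<le> s" "s \<le> d\<^sup>2 / (2 * m)"
    and \<mu>: "\<mu> \<noteq> 0" "Re \<mu> \<ge> 0"
  shows "s < cmod (m * \<mu>\<^sup>2 + d * \<mu> + s)"
proof -
  obtain a b where ab: "\<mu> = Complex a b" by (cases \<mu>)
  have a: "a \<ge> 0" using \<mu>(2) by (simp add: ab)
  define q where "q = a\<^sup>2 + b\<^sup>2"
  have q: "q > 0" using \<mu>(1) by (simp add: q_def ab sum_power2_gt_zero_iff complex_eq_iff)
  have "2 * s * m * b\<^sup>2 \<le> d\<^sup>2 * b\<^sup>2"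
    using s(2) m by (intro mult_right_mono) (simp_all add: field_simps)
  moreover have "0 < m\<^sup>2 * q\<^sup>2" using m q by simp
  moreover have "0 \<le> 2 * m * a * d * q + a\<^sup>2 * d\<^sup>2 + 2 * s * (m * a\<^sup>2 + d * a)"
    using m d s a q by simp
  ultimately have "0 < m\<^sup>2 * q\<^sup>2 + (2 * m * a * d * q + a\<^sup>2 * d\<^sup>2 + 2 * s * (m * a\<^sup>2 + d * a))
      + d\<^sup>2 * b\<^sup>2 - 2 * s * m * b\<^sup>2" by linarith
  also have "\<dots> = (m * (a\<^sup>2 - b\<^sup>2) + d * a + s)\<^sup>2 + (m * (2 * a * b) + d * b)\<^sup>2 - s\<^sup>2"
    by (simp add: q_def power2_eq_square algebra_simps)
  also have "\<dots> = (cmod (m * \<mu>\<^sup>2 + d * \<mu> + s))\<^sup>2 - s\<^sup>2"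
  proof -
    have "m * \<mu>\<^sup>2 + d * \<mu> + s = Complex (m * (a\<^sup>2 - b\<^sup>2) + d * a + s) (m * (2 * a * b) + d * b)"
      by (simp add: ab complex_eq_iff power2_eq_square)
    then show ?thesis by (simp add: cmod_power2)
  qed
  finally have "s\<^sup>2 < (cmod (m * \<mu>\<^sup>2 + d * \<mu> + s))\<^sup>2" by simp
  then show ?thesis by (rule power_less_imp_less_base) simp
qed

lemma finite_argmax: "\<exists>i. \<forall>k. u k \<le> (u i :: real)" for u :: "'n::finite \<Rightarrow> real"
proof -
  have "Max (range u) \<in> range u" by (intro Max_in) auto
  then obtain i where "Max (range u) = u i" by blast
  then have "\<forall>k. u k \<le> u i" by (metis Max_ge finite rangeI finite_imageI)
  then show ?thesis ..
qed

text \<open>A Gershgorin estimate for a quadratic matrix pencil. The weights may be asymmetric, as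
  they are for lossy lines, so rows are compared instead of using an energy form.\<close>

lemma damped_network_eigenvalue:
  fixes a :: "'n::finite \<Rightarrow> complex" and w :: "'n \<Rightarrow> 'n \<Rightarrow> real" and m d :: "'n \<Rightarrow> real"
    and \<mu> :: complex
  assumes eq: "\<And>i. (m i * \<mu>\<^sup>2 + d i * \<mu>) * a i + (\<Sum>k\<in>UNIV. w i k * (a i - a k)) = 0"
    and a: "a j \<noteq> 0" and m: "\<And>i. m i > 0" and d: "\<And>i. d i > 0"
    and w: "\<And>i k. i \<noteq> k \<Longrightarrow> w i k \<ge> 0"
    and damping: "\<And>i. (\<Sum>k\<in>UNIV - {i}. w i k) \<le> (d i)\<^sup>2 / (2 * m i)"
    and \<mu>: "\<mu> \<noteq> 0"
  shows "Re \<mu> < 0"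
proof (rule ccontr)
  assume "\<not> Re \<mu> < 0"
  obtain i where i: "\<And>k. cmod (a k) \<le> cmod (a i)"
    using finite_argmax[of "\<lambda>i. cmod (a i)"] by blast
  have ai: "cmod (a i) > 0" using a by (intro order_less_le_trans[OF _ i[of j]]) simp
  define s where "s = (\<Sum>k\<in>UNIV - {i}. w i k)"
  have s: "s \<ge> 0" unfolding s_def by (intro sum_nonneg w) auto
  have "(\<Sum>k\<in>UNIV. w i k * (a i - a k)) = (\<Sum>k\<in>UNIV - {i}. w i k * (a i - a k))"
    by (simp add: sum.remove[of UNIV i])
  also have "\<dots> = s * a i - (\<Sum>k\<in>UNIV - {i}. w i k * a k)"
    by (simp add: s_def right_diff_distrib sum_subtractf sum_distrib_right)
  finally have "(m i * \<mu>\<^sup>2 + d i * \<mu> + s) * a i = (\<Sum>k\<in>UNIV - {i}. w i k * a k)"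
    using eq[of i] by (simp add: distrib_right eq_neg_iff_add_eq_0 add_eq_0_iff2)
  then have "cmod (m i * \<mu>\<^sup>2 + d i * \<mu> + s) * cmod (a i) = cmod (\<Sum>k\<in>UNIV - {i}. w i k * a k)"
    by (metis norm_mult)
  also have "\<dots> \<le> (\<Sum>k\<in>UNIV - {i}. w i k * cmod (a i))"
    by (intro sum_norm_le) (use w i in \<open>auto simp: norm_mult intro!: mult_left_mono\<close>)
  also have "\<dots> = s * cmod (a i)" by (simp add: s_def sum_distrib_right)
  finally have "cmod (m i * \<mu>\<^sup>2 + d i * \<mu> + s) \<le> s" using ai by simp
  moreover have "s < cmod (m i * \<mu>\<^sup>2 + d i * \<mu> + s)"
    using damped_oscillator_gain[OF m d s _ \<mu>] damping[of i] \<open>\<not> Re \<mu> < 0\<close>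
    by (simp add: s_def)
  ultimately show False by simp
qed

text \<open>At a maximum of u every term of the sum is nonnegative. Applied to u and -u, this shows
  that a Laplacian image proportional to the positive vector d is zero.\<close>

lemma laplacian_sign:
  fixes u :: "'n::finite \<Rightarrow> real"
  assumes w: "\<And>i k. i \<noteq> k \<Longrightarrow> w i k \<ge> 0" and d: "\<And>i. d i > 0"
    and eq: "\<And>i. (\<Sum>k\<in>UNIV. w i k * (u i - u k)) = c * d i"
  shows "c \<ge> 0"
proof -
  obtain i where i: "\<And>k. u k \<le> u i" using finite_argmax[of u] by blast
  have "0 \<le> w i k * (u i - u k)" for k
    using w[of i k] i[of k] by (cases "i = k") auto
  then have "0 \<le> c * d i" unfolding eq[symmetric] by (intro sum_nonneg)
  then show ?thesis using d[of i] by (simp add: zero_le_mult_iff)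
qed

text \<open>At a maximum the terms are nonnegative with sum zero, so each vanishes and every
  neighbour is a maximum too. Connectedness spreads this to all nodes.\<close>

lemma laplacian_kernel_constant:
  fixes u :: "'n::finite \<Rightarrow> real"
  assumes w: "\<And>i k. i \<noteq> k \<Longrightarrow> w i k \<ge> 0" and wE: "\<And>i k. (i, k) \<in> E \<Longrightarrow> w i k > 0"
    and conn: "\<And>i k. i \<noteq> k \<Longrightarrow> (i, k) \<in> E\<^sup>+"
    and eq: "\<And>i. (\<Sum>k\<in>UNIV. w i k * (u i - u k)) = 0"
  shows "u i = u k"
proof -
  obtain j where j: "\<And>k. u k \<le> u j" using finite_argmax[of u] by blast
  have adj: "u l = u j" if "u i = u j" "(i, l) \<in> E" for i l
  proof -
    have "0 \<le> w i k * (u i - u k)" for k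
      using w[of i k] j[of k] that(1) by (cases "i = k") auto
    then have "w i l * (u i - u l) = 0"
      using eq[of i] by (subst (asm) sum_nonneg_eq_0_iff) auto
    with wE[OF that(2)] that(1) show ?thesis by simp
  qed
  have "u l = u j" for l
  proof (cases "l = j")
    case False
    then have "(j, l) \<in> E\<^sup>+" by (intro conn) simp
    then show ?thesis
    proof (induction rule: trancl_induct)
      case (base l)
      then show ?case by (rule adj[OF refl])
    next
      case (step l l')
      then show ?case by (intro adj[of l l'])
    qed
  qed simp
  then show ?thesis by metis
qed

section \<open>The referred microgrid system\<close>

lemma block_jacobian_complex_mult:
  fixes x :: "real^('n::finite + 'n)" and v :: "complex^('n + 'n)"
    and y :: "complex^'n^'n" and V m d :: "real^'n"
  defines "w \<equiv> \<lambda>i k. V $ i * V $ k * Ymod y i k * sin (Yarg y i k - angles x $ i + angles x $ k)"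
  shows "(map_matrix of_real (block_jacobian y V m d x) *v v) $ Inl i = v $ Inr i"
    and "(map_matrix of_real (block_jacobian y V m d x) *v v) $ Inr i =
      - ((\<Sum>k\<in>UNIV. w i k * (v $ Inl i - v $ Inl k)) + d $ i * v $ Inr i) / m $ i"
proof -
  show "(map_matrix of_real (block_jacobian y V m d x) *v v) $ Inl i = v $ Inr i"
    by (simp add: matrix_vector_mult_def map_matrix_def block_jacobian_def sum_UNIV_Plus if_distrib
        if_distribR cong: if_cong)
  have "(\<Sum>k\<in>UNIV. complex_of_real (Pe_jacobian y V (angles x) $ i $ k) * v $ Inl k) =
      (\<Sum>k\<in>UNIV - {i}. w i k) * v $ Inl i + (\<Sum>k\<in>UNIV - {i}. - w i k * v $ Inl k)"
    by (simp add: Pe_jacobian_def sum.remove[of UNIV i] w_def)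
  also have "\<dots> = (\<Sum>k\<in>UNIV - {i}. w i k * (v $ Inl i - v $ Inl k))"
    by (simp add: sum_distrib_right right_diff_distrib sum_subtractf sum_negf)
  also have "\<dots> = (\<Sum>k\<in>UNIV. w i k * (v $ Inl i - v $ Inl k))"
    by (simp add: sum.remove[of UNIV i])
  finally have L: "(\<Sum>k\<in>UNIV. complex_of_real (Pe_jacobian y V (angles x) $ i $ k) * v $ Inl k) =
      (\<Sum>k\<in>UNIV. w i k * (v $ Inl i - v $ Inl k))" .
  have "(map_matrix of_real (block_jacobian y V m d x) *v v) $ Inr i =
      - ((\<Sum>k\<in>UNIV. complex_of_real (Pe_jacobian y V (angles x) $ i $ k) * v $ Inl k)
        + d $ i * v $ Inr i) / m $ i"
    by (simp add: matrix_vector_mult_def map_matrix_def block_jacobian_def sum_UNIV_Plus if_distrib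
        if_distribR divide_inverse sum_distrib_left sum_distrib_right sum_negf algebra_simps cong: if_cong)
  then show "(map_matrix of_real (block_jacobian y V m d x) *v v) $ Inr i =
      - ((\<Sum>k\<in>UNIV. w i k * (v $ Inl i - v $ Inl k)) + d $ i * v $ Inr i) / m $ i"
    by (simp only: L)
qed

text \<open>
  The last term, which vanishes on \<open>referred_states r\<close>, moves the eigenvalue \<open>0\<close> belonging to the
  frozen angle of the reference bus to \<open>-1\<close>; this makes the linearization on the whole space Hurwitz.
\<close>

definition pinned_field ::
  "complex^'n^'n \<Rightarrow> real^'n \<Rightarrow> real^'n \<Rightarrow> real^'n \<Rightarrow> real^'n \<Rightarrow> 'n::finite \<Rightarrow> real^('n + 'n) \<Rightarrow> real^('n + 'n)"
  where "pinned_field y V Ps m d r z = referred_field y V Ps m d r z - axis (Inl r) (z $ Inl r)"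

text \<open>The second term comes from composing with \<open>refer_to r\<close>, the third from the
  pinning term.\<close>

definition pinned_jacobian ::
  "complex^'n^'n \<Rightarrow> real^'n \<Rightarrow> real^'n \<Rightarrow> real^'n \<Rightarrow> 'n::finite \<Rightarrow> real^('n + 'n) \<Rightarrow> real^('n + 'n)^('n + 'n)"
  where "pinned_jacobian y V m d r z = (\<chi> s t. block_jacobian y V m d z $ s $ t
    - (case s of Inl i \<Rightarrow> block_jacobian y V m d z $ Inl r $ t | Inr i \<Rightarrow> 0)
    - (if s = Inl r \<and> t = Inl r then 1 else 0))"

text \<open>The scalars are generic because the formula serves real vectors for the derivative and
  complex ones for eigenvectors.\<close>

lemma pinned_jacobian_mult:
  fixes v :: "'b::real_algebra_1^('n::finite + 'n)"
  shows "(map_matrix of_real (pinned_jacobian y V m d r z) *v v) $ s =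
     (map_matrix of_real (block_jacobian y V m d z) *v v) $ s
     - (case s of Inl i \<Rightarrow> (map_matrix of_real (block_jacobian y V m d z) *v v) $ Inl r | Inr i \<Rightarrow> 0)
     - (if s = Inl r then v $ Inl r else 0)"
proof -
  have "(if s = Inl r \<and> t = Inl r then 1 else 0) * v $ t = (if t = Inl r then if s = Inl r then v $ Inl r else 0 else 0)"
    for t by simp
  then show ?thesis
    by (cases s)
       (simp_all add: pinned_jacobian_def matrix_vector_mult_def map_matrix_def left_diff_distrib
         sum_subtractf if_distrib[of of_real] cong: if_cong)
qed

lemma has_derivative_pinned_field:
  fixes z :: "real^('n::finite + 'n)"
  shows "(pinned_field y V Ps m d r has_derivative (\<lambda>h. pinned_jacobian y V m d r z *v h)) (at z)"
proof (rule has_derivative_vec_nthI)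
  fix s :: "'n + 'n"
  let ?F = "microgrid_field y V Ps m d" and ?J = "block_jacobian y V m d z"
  have real_id: "map_matrix of_real M = M" for M :: "real^('n + 'n)^('n + 'n)"
    by (simp add: map_matrix_def vec_eq_iff)
  have nth: "((\<lambda>x. x $ t) has_derivative (\<lambda>h. h $ t)) (at x)" for t :: "'n + 'n" and x :: "real^('n + 'n)"
    by (intro bounded_linear_imp_has_derivative bounded_linear_vec_nth)
  have F: "((\<lambda>x. ?F x $ t) has_derivative (\<lambda>h. (?J *v h) $ t)) (at z)" for t
    using has_derivative_compose[OF has_derivative_microgrid_field nth] .
  have "((\<lambda>x. ?F x $ s - (case s of Inl i \<Rightarrow> ?F x $ Inl r | Inr i \<Rightarrow> 0) - (if s = Inl r then x $ Inl r else 0))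
      has_derivative (\<lambda>h. (?J *v h) $ s - (case s of Inl i \<Rightarrow> (?J *v h) $ Inl r | Inr i \<Rightarrow> 0)
        - (if s = Inl r then h $ Inl r else 0))) (at z)"
    by (cases s; cases "s = Inl r") (auto intro!: has_derivative_diff has_derivative_minus F nth has_derivative_const)
  moreover have "pinned_field y V Ps m d r x $ s =
      ?F x $ s - (case s of Inl i \<Rightarrow> ?F x $ Inl r | Inr i \<Rightarrow> 0) - (if s = Inl r then x $ Inl r else 0)" for x
    by (cases s) (simp_all add: pinned_field_def referred_field_def refer_to_def state_def angles_def freqs_def axis_def)
  moreover have "(pinned_jacobian y V m d r z *v h) $ s = (?J *v h) $ s
      - (case s of Inl i \<Rightarrow> (?J *v h) $ Inl r | Inr i \<Rightarrow> 0) - (if s = Inl r then h $ Inl r else 0)" for h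
    using pinned_jacobian_mult[of y V m d r z h s] by (simp only: real_id)
  ultimately show "((\<lambda>x. pinned_field y V Ps m d r x $ s) has_derivative
      (\<lambda>h. (pinned_jacobian y V m d r z *v h) $ s)) (at z)"
    by simp
qed

text \<open>The only nonlinearity is the cosine of affine functions of the angles, so one Lipschitz
  constant works globally and solutions never blow up.\<close>

lemma referred_field_lipschitz:
  fixes y :: "complex^'n^'n::finite"
  shows "\<exists>L. L-lipschitz_on UNIV (referred_field y V Ps m d r)"
proof (rule lipschitz_on_vec)
  fix s :: "'n + 'n"
  show "\<exists>L. L-lipschitz_on UNIV (\<lambda>z. referred_field y V Ps m d r z $ s)"
  proof (cases s)
    case (Inl i)
    have "(1 + 1)-lipschitz_on UNIV (\<lambda>z::real^('n + 'n). z $ Inr i - z $ Inr r)"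
      by (intro lipschitz_on_diff lipschitz_on_vec_nth)
    then show ?thesis by (auto simp: Inl referred_field_nth freqs_def)
  next
    case (Inr i)
    let ?c = "\<lambda>k z. V $ i * V $ k * Ymod y i k * cos (Yarg y i k - z $ Inl i + z $ Inl k)"
    have "\<exists>L. L-lipschitz_on UNIV (\<lambda>z::real^('n + 'n). ?c k z)" for k
    proof -
      have "(1 * (0 + 1 + 1))-lipschitz_on UNIV
          (\<lambda>z::real^('n + 'n). cos (Yarg y i k - z $ Inl i + z $ Inl k))"
        by (intro lipschitz_on_compose2[of _ _ _ _ cos] lipschitz_on_add lipschitz_on_diff
            lipschitz_on_constant lipschitz_on_vec_nth lipschitz_on_subset[OF lipschitz_on_cos]) auto
      from lipschitz_on_cmult_real[OF this] show ?thesis by blast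
    qed
    then obtain L where L: "L-lipschitz_on UNIV (\<lambda>z::real^('n + 'n). \<Sum>k\<in>UNIV. ?c k z)"
      using lipschitz_on_sum[of UNIV UNIV ?c] by auto
    have "(\<bar>inverse (m $ i)\<bar> * (0 + L + \<bar>d $ i\<bar> * 1))-lipschitz_on UNIV
        (\<lambda>z. inverse (m $ i) * (Ps $ i - (\<Sum>k\<in>UNIV. ?c k z) - d $ i * z $ Inr i))"
      by (intro lipschitz_on_cmult_real lipschitz_on_diff L lipschitz_on_vec_nth lipschitz_on_constant)
    then show ?thesis
      by (auto simp: Inr referred_field_nth freqs_def angles_def Pe_def divide_inverse mult.commute)
  qed
qed

text \<open>The reference angle has derivative zero along the referred field, so a global solution
  of the whole space that starts in \<open>referred_states r\<close> remains there.\<close>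

lemma referred_field_solution_exists:
  assumes x0: "x0 \<in> referred_states r"
  shows "\<exists>x. solves_ode_in (referred_states r) (referred_field y V Ps m d r) x \<and> x 0 = x0"
proof -
  let ?F = "referred_field y V Ps m d r"
  obtain L where "L-lipschitz_on UNIV ?F" using referred_field_lipschitz by blast
  then obtain x where x: "solves_ode_in UNIV ?F x" "x 0 = x0"
    by (rule lipschitz_ode_global_solution)
  have "((\<lambda>t. x t $ Inl r) has_field_derivative 0) (at t within {0..})" if "t \<in> {0..}" for t
  proof -
    have "(x has_vector_derivative ?F (x t)) (at t within {0..})"
      using x(1) that by (simp add: solves_ode_in_def)
    from bounded_linear.has_vector_derivative[OF bounded_linear_vec_nth this, of "Inl r"]
    show ?thesis
      by (simp add: referred_field_nth has_real_derivative_iff_has_vector_derivative)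
  qed
  then obtain c where c: "\<And>t. t \<in> {0..} \<Longrightarrow> x t $ Inl r = c"
    using has_field_derivative_zero_constant[of "{0..}" "\<lambda>t. x t $ Inl r"] by auto
  have "c = 0" using c[of 0] x(2) x0 by (simp add: referred_states_def angles_def)
  then have "solves_ode_in (referred_states r) ?F x"
    using x(1) c by (simp add: solves_ode_in_def referred_states_def angles_def)
  with x(2) show ?thesis by blast
qed

section \<open>Spectrum of the Jacobian at a point of \<open>Omega\<close>\<close>

locale microgrid_equilibrium =
  fixes y :: "complex^'n^'n::finite" and V m d :: "real^'n" and x :: "real^('n + 'n)"
  assumes V_pos: "\<And>i. V $ i > 0"
    and m_pos: "\<And>i. m $ i > 0"
    and d_pos: "\<And>i. d $ i > 0"
    and connected: "grid_connected y"
    and x_in_Omega: "x \<in> Omega y"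
    and damping: "\<And>i. (\<Sum>k\<in>UNIV - {i}. V $ i * V $ k * Ymod y i k) \<le> (d $ i)\<^sup>2 / (2 * m $ i)"
begin

text \<open>Edge weights whose Laplacian is the block L of the Jacobian; membership in
  \<open>Omega\<close> makes the sine positive on every line.\<close>

definition weight :: "'n \<Rightarrow> 'n \<Rightarrow> real" where
  "weight i k = V $ i * V $ k * Ymod y i k * sin (Yarg y i k - angles x $ i + angles x $ k)"

lemma weight_pos: "(i, k) \<in> lines y \<Longrightarrow> weight i k > 0"
  using x_in_Omega V_pos
  by (auto simp: weight_def Omega_def lines_def Ymod_def admittance_matrix_def
      intro!: mult_pos_pos sin_gt_zero)

lemma weight_nonneg: "i \<noteq> k \<Longrightarrow> weight i k \<ge> 0"
  using weight_pos[of i k]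
  by (cases "y $ i $ k = 0") (auto simp: lines_def weight_def Ymod_def admittance_matrix_def)

lemma weight_damping: "(\<Sum>k\<in>UNIV - {i}. weight i k) \<le> (d $ i)\<^sup>2 / (2 * m $ i)"
proof (rule order_trans[OF sum_mono damping])
  fix k
  have "0 \<le> V $ i * V $ k * Ymod y i k"
    using V_pos[of i] V_pos[of k] by (simp add: Ymod_def)
  then show "weight i k \<le> V $ i * V $ k * Ymod y i k"
    unfolding weight_def by (rule mult_left_le[OF sin_le_one])
qed

abbreviation "cJ \<equiv> map_matrix complex_of_real (block_jacobian y V m d x)"

lemma nonzero_eigenvalue_stable:
  assumes v: "v \<noteq> 0" "cJ *v v = \<mu> *s v" and \<mu>: "\<mu> \<noteq> 0"
  shows "Re \<mu> < 0"
proof -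
  have freq: "v $ Inr i = \<mu> * v $ Inl i" for i
    using arg_cong[OF v(2), of "\<lambda>u. u $ Inl i"] by (simp add: block_jacobian_complex_mult)
  have "(m $ i * \<mu>\<^sup>2 + d $ i * \<mu>) * v $ Inl i + (\<Sum>k\<in>UNIV. weight i k * (v $ Inl i - v $ Inl k)) = 0" for i
  proof -
    have "- ((\<Sum>k\<in>UNIV. weight i k * (v $ Inl i - v $ Inl k)) + d $ i * v $ Inr i) / m $ i = \<mu> * v $ Inr i"
      using arg_cong[OF v(2), of "\<lambda>u. u $ Inr i"] by (simp add: block_jacobian_complex_mult weight_def)
    then have "- ((\<Sum>k\<in>UNIV. weight i k * (v $ Inl i - v $ Inl k)) + d $ i * v $ Inr i) = m $ i * (\<mu> * v $ Inr i)"
      using m_pos[of i] by (simp add: field_simps)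
    then show ?thesis by (simp add: freq power2_eq_square algebra_simps add_eq_0_iff)
  qed
  \<comment> \<open>The frequency part is \<open>\<mu>\<close> times the angle part, so a vanishing
    angle part would force v = 0.\<close>
  moreover obtain j where "v $ Inl j \<noteq> 0"
  proof (rule ccontr)
    assume "\<not> thesis"
    with that have "v $ Inl j = 0" for j by blast
    then have "v $ s = 0" for s using freq by (cases s) auto
    with v(1) show False by (simp add: vec_eq_iff)
  qed
  ultimately show ?thesis
    using m_pos d_pos weight_nonneg weight_damping \<mu>
    by (intro damped_network_eigenvalue[where a = "\<lambda>i. v $ Inl i" and w = weight
          and m = "\<lambda>i. m $ i" and d = "\<lambda>i. d $ i"])
qed

text \<open>Excludes the eigenvalue 0 of the referred system. All frequencies equal c, so the
  Laplacian of the angles is -c d; this forces c = 0. Then connectedness makes the angles equal,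
  hence zero as at bus r.\<close>

lemma uniform_rotation_trivial:
  assumes rot: "\<And>i. (cJ *v v) $ Inl i = c" and "\<And>i. (cJ *v v) $ Inr i = 0" and v: "v $ Inl r = 0"
  shows "v = 0"
proof -
  have freq: "v $ Inr i = c" for i
    using rot[of i] by (simp add: block_jacobian_complex_mult)
  have eq: "(\<Sum>k\<in>UNIV. weight i k * (v $ Inl i - v $ Inl k)) = - c * d $ i" for i
  proof -
    have "- ((\<Sum>k\<in>UNIV. weight i k * (v $ Inl i - v $ Inl k)) + d $ i * c) / m $ i = 0"
      using assms(2)[of i] unfolding block_jacobian_complex_mult freq weight_def .
    then have "(\<Sum>k\<in>UNIV. weight i k * (v $ Inl i - v $ Inl k)) + c * d $ i = 0"
      using m_pos[of i] by (simp only: divide_eq_0_iff neg_equal_0_iff_equal of_real_eq_0_iff) (auto simp: mult.commute)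
    then show ?thesis by (simp only: eq_neg_iff_add_eq_0 mult_minus_left)
  qed
  \<comment> \<open>The maximum principle needs an order; the weights are real, so real and
    imaginary parts separate.\<close>
  have re: "(\<Sum>k\<in>UNIV. weight i k * (Re (v $ Inl i) - Re (v $ Inl k))) = - Re c * d $ i" for i
    using arg_cong[OF eq, of Re i] by (simp add: Re_sum)
  have im: "(\<Sum>k\<in>UNIV. weight i k * (Im (v $ Inl i) - Im (v $ Inl k))) = - Im c * d $ i" for i
    using arg_cong[OF eq, of Im i] by (simp add: Im_sum)
  have zero: "b = 0" if "\<And>i. (\<Sum>k\<in>UNIV. weight i k * (u i - u k)) = - b * d $ i" for u :: "'n \<Rightarrow> real" and b
  proof -
    have "(\<Sum>k\<in>UNIV. weight i k * (- u i - - u k)) = b * d $ i" for i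
    proof -
      have "(\<Sum>k\<in>UNIV. weight i k * (- u i - - u k)) = - (\<Sum>k\<in>UNIV. weight i k * (u i - u k))"
        by (simp add: sum_negf[symmetric] algebra_simps)
      then show ?thesis using that[of i] by simp
    qed
    then have "b \<ge> 0" using laplacian_sign[of weight "\<lambda>i. d $ i" "\<lambda>i. - u i" b] weight_nonneg d_pos by blast
    moreover have "- b \<ge> 0"
      using laplacian_sign[of weight "\<lambda>i. d $ i" u "- b"] weight_nonneg d_pos that by blast
    ultimately show ?thesis by simp
  qed
  have "Re c = 0" by (rule zero[OF re])
  moreover have "Im c = 0" by (rule zero[OF im])
  ultimately have c: "c = 0" by (simp add: complex_eq_iff)
  have const: "u i = u r" if "\<And>i. (\<Sum>k\<in>UNIV. weight i k * (u i - u k)) = 0" for u :: "'n \<Rightarrow> real" and i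
    using laplacian_kernel_constant[of weight "lines y" u i r] weight_nonneg weight_pos that connected
    by (auto simp: grid_connected_def)
  have "Re (v $ Inl i) = Re (v $ Inl r)" "Im (v $ Inl i) = Im (v $ Inl r)" for i
    using re im by (auto intro!: const[where u = "\<lambda>i. Re (v $ Inl i)"] const[where u = "\<lambda>i. Im (v $ Inl i)"] simp: c)
  then have "v $ Inl i = 0" for i using v by (simp add: complex_eq_iff)
  then have "v $ s = 0" for s using freq c by (cases s) auto
  then show ?thesis by (simp add: vec_eq_iff)
qed

lemma pinned_jacobian_hurwitz:
  assumes "complex_eigenvalue (pinned_jacobian y V m d r x) \<mu>"
  shows "Re \<mu> < 0"
proof -
  obtain v where v: "v \<noteq> 0" "map_matrix of_real (pinned_jacobian y V m d r x) *v v = \<mu> *s v"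
    using assms by (auto simp: complex_eigenvalue_def)
  define c where "c = (cJ *v v) $ Inl r"
  have comp: "(cJ *v v) $ s - (case s of Inl i \<Rightarrow> c | Inr i \<Rightarrow> 0) - (if s = Inl r then v $ Inl r else 0) = \<mu> * v $ s" for s
    using arg_cong[OF v(2), of "\<lambda>u. u $ s"]
    by (simp only: pinned_jacobian_mult c_def vector_smult_component)
  \<comment> \<open>In the row of the reference bus only the pinning term survives. So either the
    eigenvalue is the artificial -1, or v lies in the referred space.\<close>
  have "\<mu> * v $ Inl r = - v $ Inl r"
    using comp[of "Inl r"] by (simp add: c_def)
  then have "(\<mu> + 1) * v $ Inl r = 0" by (simp only: distrib_right mult_1_left) simp
  then consider "\<mu> = - 1" | "v $ Inl r = 0" by (auto simp: eq_neg_iff_add_eq_0)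
  then show ?thesis
  proof cases
    case 2
    have Jl: "(cJ *v v) $ Inl i = \<mu> * v $ Inl i + c" for i
      using comp[of "Inl i"] 2 by (auto simp: algebra_simps split: if_splits)
    have Jr: "(cJ *v v) $ Inr i = \<mu> * v $ Inr i" for i
      using comp[of "Inr i"] by simp
    show ?thesis
    proof (cases "\<mu> = 0")
      case True
      have "v = 0" by (rule uniform_rotation_trivial[OF _ _ 2]) (simp_all add: Jl Jr True)
      with v(1) show ?thesis by simp
    next
      case False
      \<comment> \<open>J maps v to \<open>\<mu>\<close> v plus a uniform rotation at rate c.
        Uniform rotations lie in the kernel of J, so shifting all angles by c / \<open>\<mu>\<close>
        gives a true eigenvector of J. It is nonzero, because its entry at r is c /
        \<open>\<mu>\<close> and v would vanish with it.\<close>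
      define u where "u = v + (\<chi> s. case s of Inl i \<Rightarrow> c / \<mu> | Inr i \<Rightarrow> 0)"
      have ul: "u $ Inl i = v $ Inl i + c / \<mu>" and ur: "u $ Inr i = v $ Inr i" for i
        by (simp_all add: u_def)
      have Ju: "(cJ *v u) $ s = (cJ *v v) $ s" for s
        by (cases s) (simp_all add: block_jacobian_complex_mult ul ur)
      have "(cJ *v u) $ s = \<mu> * u $ s" for s
        using False by (cases s) (simp_all add: Ju Jl Jr ul ur distrib_left)
      then have "cJ *v u = \<mu> *s u"
        by (simp add: vec_eq_iff)
      moreover have "u \<noteq> 0"
      proof
        assume u: "u = 0"
        then have "c / \<mu> = 0" using ul[of r] 2 by simp
        then have "v $ s = 0" for s using ul ur u by (cases s) auto
        with v(1) show False by (simp add: vec_eq_iff)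
      qed
      ultimately show ?thesis using nonzero_eigenvalue_stable False by blast
    qed
  qed simp
qed

end

section \<open>Transfer to the referred system\<close>

lemma block_jacobian_refer_to:
  "block_jacobian y V m d (refer_to r x) = block_jacobian y V m d x"
proof -
  have "Pe_jacobian y V (angles (refer_to r x)) = Pe_jacobian y V (angles x)"
    by (simp add: vec_eq_iff Pe_jacobian_def refer_to_def state_def angles_def algebra_simps)
  then show ?thesis by (simp only: block_jacobian_def)
qed

theorem corollary1:
  fixes y :: "complex^'n^'n"
    and V Ps m d :: "real^'n"
    and x :: "real^('n + 'n)"
    and J :: "real^('n + 'n)^('n + 'n)"
    and r :: 'n
  assumes y_sym: "\<And>i k. y $ i $ k = y $ k $ i"
    and conductance: "\<And>i k. i \<noteq> k \<Longrightarrow> Re (y $ i $ k) \<ge> 0"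
    and susceptance: "\<And>i k. i \<noteq> k \<Longrightarrow> Im (y $ i $ k) \<le> 0"
    and V_pos: "\<And>i. V $ i > 0"
    and m_pos: "\<And>i. m $ i > 0"
    and d_pos: "\<And>i. d $ i > 0"
    and connected: "grid_connected y"
    and EP: "equilibrium_point y V Ps x"
    and x_in_Omega: "x \<in> Omega y"
    and J: "J = jacobian (microgrid_field y V Ps m d) (at x)"
    and damping: "\<And>i. (\<Sum>k\<in>UNIV - {i}. V $ i * V $ k * Ymod y i k) \<le> (d $ i)\<^sup>2 / (2 * m $ i)"
  shows "(\<forall>\<mu>. complex_eigenvalue J \<mu> \<and> \<mu> \<noteq> 0 \<longrightarrow> Re \<mu> < 0) \<and>
         locally_asymptotically_stable (referred_states r) (referred_field y V Ps m d r) (refer_to r x)"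
proof
  interpret microgrid_equilibrium y V m d x
    by unfold_locales (fact V_pos m_pos d_pos connected x_in_Omega damping)+
  show "\<forall>\<mu>. complex_eigenvalue J \<mu> \<and> \<mu> \<noteq> 0 \<longrightarrow> Re \<mu> < 0"
    unfolding J jacobian_microgrid_field complex_eigenvalue_def
    using nonzero_eigenvalue_stable by blast
  let ?F = "referred_field y V Ps m d r" and ?G = "pinned_field y V Ps m d r"
  let ?X = "referred_states r" and ?p = "refer_to r x"
  have p: "?p \<in> ?X"
    by (simp add: referred_states_def refer_to_def state_def angles_def)
  have FG: "?G z = ?F z" if "z \<in> ?X" for z
    using that by (simp add: pinned_field_def referred_states_def angles_def vec_eq_iff axis_def)
  \<comment> \<open>Both fields agree on the referred states, so they have the same trajectories
    there and stability passes from one to the other.\<close>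
  then have ode: "solves_ode_in ?X ?G = solves_ode_in ?X ?F"
    by (auto simp: solves_ode_in_def fun_eq_iff)
  have Fp: "?F ?p = 0"
  proof -
    have "microgrid_field y V Ps m d x = 0"
      using EP by (simp add: equilibrium_point_def microgrid_field_def state_def vec_eq_iff split: sum.split)
    then show ?thesis
      by (simp add: referred_field_def microgrid_field_refer_to)
         (simp add: refer_to_def state_def angles_def freqs_def vec_eq_iff split: sum.split)
  qed
  have "locally_asymptotically_stable ?X ?G ?p"
  proof (rule asymptotically_stable_if_linearization_stable[OF _ _ p])
    show "(?G has_derivative (\<lambda>h. pinned_jacobian y V m d r ?p *v h)) (at ?p)"
      by (rule has_derivative_pinned_field)
    show "?G ?p = 0" using FG[OF p] Fp by simp
    \<comment> \<open>Only angle differences enter the Jacobian, so the spectral bound proved at x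
      holds at the referred equilibrium.\<close>
    have "pinned_jacobian y V m d r ?p = pinned_jacobian y V m d r x"
      by (simp only: pinned_jacobian_def block_jacobian_refer_to)
    then show "Re \<mu> < 0" if "complex_eigenvalue (pinned_jacobian y V m d r ?p) \<mu>" for \<mu>
      using pinned_jacobian_hurwitz that by simp
    show "\<exists>x. solves_ode_in ?X ?G x \<and> x 0 = x0" if "x0 \<in> ?X" for x0
      unfolding ode by (rule referred_field_solution_exists[OF that])
  qed
  then show "locally_asymptotically_stable ?X ?F ?p"
    unfolding locally_asymptotically_stable_def ode using FG[OF p] by simp
qed

end
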